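(* Let $\lambda\in\mathbb C$ satisfy $q^{\lambda}=\chi_2 t a_1a_2/\theta_1$, let $\xi\in\mathbb C\setminus\{0\}$, and let $B_\infty,B_1,B_2,\overline F_\infty,\overline F_1,\overline F_2$ be the $2\times2$ matrices defined in the context. Let $Y(x)=\begin{pmatrix}y_1(x)\\ y_2(x)\end{pmatrix}$ be a solution of $$Y(qx)=\Big(B_\infty+\frac{B_1}{1-x/(ta_1)}+\frac{B_2}{1-x/(ta_2)}\Big)Y(x).$$ Define $$\check y_1(x)=\frac{t(\chi_2ta_1a_2-\theta_1)}{qwyz\chi_2(\chi_1ta_1a_2-\theta_1)}\int_0^{\xi\infty}\frac{y_1(s)}{s-x}P_\lambda(x,s)\,d_qs,$$ $$\check y_2(x)=\frac{1}{qwyz\chi_2a_1a_2}\int_0^{\xi\infty}\Big\{\frac{qz\theta_1}{s-qy}-\frac{ta_1a_2}{s-y}+\Big(\frac{qz\theta_1-ta_1a_2}{\chi_1ta_1a_2-\theta_1}-\frac{q^2yz}{s-qy}\Big)\frac{\chi_2ta_1a_2-\theta_1}{x-s}\Big\}y_1(s)P_\lambda(x,s)\,d_qs .$$ Then $\overline Y(x)=\begin{pmatrix}\check y_1(x)\\ \check y_2(x)\end{pmatrix}$ formally (in the sense explained in the context) satisfies $$\overline Y(qx)=\Big(\overline F_\infty+\frac{\overline F_1}{1-x/(ta_1)}+\frac{\overline F_2}{1-x/(ta_2)}\Big)\overline Y(x).$$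
   Context: Parameters: $q\in\mathbb C$ with $0<|q|<1$; $t,a_1,a_2,a_3,a_4,\chi_1,\chi_2,\theta_1,\theta_2,w,y,z$ are nonzero complex numbers with $\chi_1\chi_2a_1a_2a_3a_4=\theta_1\theta_2$, generic so that all denominators below are nonzero (in particular $a_1\ne a_2$, $\chi_1\neq\chi_2$, $\chi_1ta_1a_2\ne\theta_1$). Jackson integral: $\int_0^{\xi\infty}f(s)\,d_qs=(1-q)\sum_{n=-\infty}^{\infty}q^n\xi f(q^n\xi)$. Kernel: $P_\lambda(x,s)=\prod_{i=0}^\infty\frac{x-q^{i+\lambda+1}s}{x-q^{i+1}s}$. The matrices $B$: $B_\infty=\frac{ta_1a_2}{\theta_1}\begin{pmatrix}\chi_1&0\\ 0&\chi_2\end{pmatrix}$, $$B_1=\frac{a_2}{t\theta_1(a_1-a_2)}\begin{pmatrix}\dfrac{(y-ta_1)b_1^{[1]}}{qyz(\chi_1-\chi_2)}&w\chi_2(y-ta_1)\\[2mm] -\dfrac{b_1^{[1]}b_2^{[1]}}{q^2wy^2z^2(\chi_1-\chi_2)^2}&-\dfrac{\chi_2b_2^{[1]}}{qyz(\chi_1-\chi_2)}\end{pmatrix},$$ $b_1^{[1]}=q^2\chi_1^2\chi_2(y-a_3)(y-a_4)z^2+(y-ta_2)(\chi_2y-\chi_1ta_1)-q\chi_1\{2\chi_2y^2-(\chi_1ta_1+\chi_2ta_2+\chi_2a_3+\chi_2a_4)y+t(\theta_1+\theta_2)\}z$, $b_2^{[1]}=q^2\chi_1(y-a_3)(y-a_4)(\chi_1y-\chi_2ta_1)z^2+(y-ta_1)^2(y-ta_2)-q(y-ta_1)\{2\chi_1y^2-(\chi_2ta_1+\chi_1ta_2+\chi_1a_3+\chi_1a_4)y+t(\theta_1+\theta_2)\}z$,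 and $B_2$ is obtained from $B_1$ by exchanging $a_1\leftrightarrow a_2$ (with $\theta_1,\theta_2$ and all other parameters unchanged). Put $B_0=I_2-B_\infty-B_1-B_2$. The matrices $\overline F$: $\overline F_\infty=\begin{pmatrix}\chi_1ta_1a_2/\theta_1&0\\ 0&1\end{pmatrix}$, $$\overline F_1=\frac{a_1}{qyz\theta_1(a_1-a_2)(\theta_1-\chi_1ta_1a_2)}\begin{pmatrix}-(y-ta_1)f_1^{[1]}a_2^2&-f_2^{[1]}(y-ta_1)a_2\\ f_1^{[1]}f_3^{[1]}a_2&f_2^{[1]}f_3^{[1]}\end{pmatrix},$$ with $f_1^{[1]}=b_1^{[1]}$, $f_2^{[1]}=q\chi_1\chi_2a_2(y-a_3)(y-a_4)z-(y-ta_2)(a_2\chi_2y-\theta_1)$, $f_3^{[1]}=q(ya_2\chi_1-\theta_1)z-a_2(y-ta_1)$, and $\overline F_2$ is obtained from $\overline F_1$ by exchanging $a_1\leftrightarrow a_2$. Meaning of "formally": Put $b_0=0$, $b_1=ta_1$, $b_2=ta_2$ and $\widehat Y_i(x)=\int_0^{\xi\infty}\frac{P_\lambda(x,s)}{s-b_i}Y(s)\,d_qs$ ($i=0,1,2$), $\widehat Y={}^t(\widehat Y_0,\widehat Y_1,\widehat Y_2)$ (a 6-vector). It is assumed that all Jackson integrals involved (these and those in the claim) are well defined and converge absolutely, and that $\widehat Y$ satisfies the $q$-convolution equation $\widehat Y(qx)=\big(F_\infty+\frac{F_1}{1-x/(ta_1)}+\frac{F_2}{1-x/(ta_2)}\big)\widehat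 Y(x)$, where, in $2\times 2$ blocks, $$F_1=\begin{pmatrix}O&O&O\\ B_0&B_1-(1-q^\lambda)I_2&B_2\\ O&O&O\end{pmatrix},\quad F_2=\begin{pmatrix}O&O&O\\ O&O&O\\ B_0&B_1&B_2-(1-q^\lambda)I_2\end{pmatrix},\quad F_\infty=I_6-\begin{pmatrix}B_0&B_1&B_2\\ B_0&B_1&B_2\\ B_0&B_1&B_2\end{pmatrix}.$$ *)

theory Defs
  imports "HOL-Analysis.Analysis"
begin

text \<open>The sample points of the Jackson integral. For \<open>x \<noteq> 0\<close> off this set, the denominators
  of \<open>kernelP q lam x s\<close> and \<open>x - s\<close> are nonzero at every sample point \<open>s\<close>.\<close>

definition q_lattice :: "complex \<Rightarrow> complex \<Rightarrow> complex set" where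
  "q_lattice q \<xi> = range (\<lambda>n::int. q powi n * \<xi>)"

definition jackson_abs_convergent :: "complex \<Rightarrow> complex \<Rightarrow> (complex \<Rightarrow> complex) \<Rightarrow> bool" where
  "jackson_abs_convergent q \<xi> f \<longleftrightarrow>
     (\<lambda>n::int. norm (q powi n * \<xi> * f (q powi n * \<xi>))) summable_on UNIV"

definition jackson_integral :: "complex \<Rightarrow> complex \<Rightarrow> (complex \<Rightarrow> complex) \<Rightarrow> complex" where
  "jackson_integral q \<xi> f =
     (1 - q) * (\<Sum>\<^sub>\<infinity>n\<in>(UNIV :: int set). q powi n * \<xi> * f (q powi n * \<xi>))"

text \<open>The exponent \<open>lam\<close> is complex and \<open>powr\<close> is the principal branch. The kernel depends on
  \<open>lam\<close> only through \<open>q powr lam\<close>.\<close>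

definition kernelP :: "complex \<Rightarrow> complex \<Rightarrow> complex \<Rightarrow> complex \<Rightarrow> complex" where
  "kernelP q lam x s =
     (\<Prod>i. (x - q powr (of_nat i + lam + 1) * s) / (x - q ^ (i + 1) * s))"

abbreviation mscale :: "complex \<Rightarrow> complex ^ 'n ^ 'm \<Rightarrow> complex ^ 'n ^ 'm" where
  "mscale c A \<equiv> map_matrix ((*) c) A"

abbreviation mat2 :: "'a \<Rightarrow> 'a \<Rightarrow> 'a \<Rightarrow> 'a \<Rightarrow> ('a::zero) ^ 2 ^ 2" where
  "mat2 a b c d \<equiv> vector [vector [a, b], vector [c, d]]"

definition coeffA :: "complex \<Rightarrow> complex \<Rightarrow> complex ^ 'n ^ 'n \<Rightarrow> complex ^ 'n ^ 'n \<Rightarrow>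
    complex ^ 'n ^ 'n \<Rightarrow> complex \<Rightarrow> complex ^ 'n ^ 'n" where
  "coeffA b1 b2 Ainf A1 A2 x =
     Ainf + mscale (1 / (1 - x / b1)) A1 + mscale (1 / (1 - x / b2)) A2"

definition Binf where
  "Binf t a1 a2 \<chi>1 \<chi>2 \<theta>1 = mscale (t * a1 * a2 / \<theta>1) (mat2 \<chi>1 0 0 \<chi>2)"

definition b1_1 :: "complex \<Rightarrow> complex \<Rightarrow> complex \<Rightarrow> complex \<Rightarrow> complex \<Rightarrow> complex \<Rightarrow>
    complex \<Rightarrow> complex \<Rightarrow> complex \<Rightarrow> complex \<Rightarrow> complex \<Rightarrow> complex \<Rightarrow> complex" where
  "b1_1 q t a1 a2 a3 a4 \<chi>1 \<chi>2 \<theta>1 \<theta>2 y z =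
     q^2 * \<chi>1^2 * \<chi>2 * (y - a3) * (y - a4) * z^2
     + (y - t * a2) * (\<chi>2 * y - \<chi>1 * t * a1)
     - q * \<chi>1 * (2 * \<chi>2 * y^2 - (\<chi>1 * t * a1 + \<chi>2 * t * a2 + \<chi>2 * a3 + \<chi>2 * a4) * y
                 + t * (\<theta>1 + \<theta>2)) * z"

definition b2_1 :: "complex \<Rightarrow> complex \<Rightarrow> complex \<Rightarrow> complex \<Rightarrow> complex \<Rightarrow> complex \<Rightarrow>
    complex \<Rightarrow> complex \<Rightarrow> complex \<Rightarrow> complex \<Rightarrow> complex \<Rightarrow> complex \<Rightarrow> complex" where
  "b2_1 q t a1 a2 a3 a4 \<chi>1 \<chi>2 \<theta>1 \<theta>2 y z =
     q^2 * \<chi>1 * (y - a3) * (y - a4) * (\<chi>1 * y - \<chi>2 * t * a1) * z^2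
     + (y - t * a1)^2 * (y - t * a2)
     - q * (y - t * a1) * (2 * \<chi>1 * y^2
         - (\<chi>2 * t * a1 + \<chi>1 * t * a2 + \<chi>1 * a3 + \<chi>1 * a4) * y + t * (\<theta>1 + \<theta>2)) * z"

definition B1 where
  "B1 q t a1 a2 a3 a4 \<chi>1 \<chi>2 \<theta>1 \<theta>2 w y z =
    (let \<beta>1 = b1_1 q t a1 a2 a3 a4 \<chi>1 \<chi>2 \<theta>1 \<theta>2 y z;
         \<beta>2 = b2_1 q t a1 a2 a3 a4 \<chi>1 \<chi>2 \<theta>1 \<theta>2 y z
     in mscale (a2 / (t * \<theta>1 * (a1 - a2)))
          (mat2 ((y - t * a1) * \<beta>1 / (q * y * z * (\<chi>1 - \<chi>2)))
                (w * \<chi>2 * (y - t * a1))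
                (- (\<beta>1 * \<beta>2) / (q^2 * w * y^2 * z^2 * (\<chi>1 - \<chi>2)^2))
                (- (\<chi>2 * \<beta>2) / (q * y * z * (\<chi>1 - \<chi>2)))))"

definition B2 where
  "B2 q t a1 a2 a3 a4 \<chi>1 \<chi>2 \<theta>1 \<theta>2 w y z = B1 q t a2 a1 a3 a4 \<chi>1 \<chi>2 \<theta>1 \<theta>2 w y z"

definition B0 where
  "B0 q t a1 a2 a3 a4 \<chi>1 \<chi>2 \<theta>1 \<theta>2 w y z =
     mat 1 - Binf t a1 a2 \<chi>1 \<chi>2 \<theta>1
       - B1 q t a1 a2 a3 a4 \<chi>1 \<chi>2 \<theta>1 \<theta>2 w y z
       - B2 q t a1 a2 a3 a4 \<chi>1 \<chi>2 \<theta>1 \<theta>2 w y z"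

definition Fbar_inf :: "complex \<Rightarrow> complex \<Rightarrow> complex \<Rightarrow> complex \<Rightarrow> complex \<Rightarrow> complex ^ 2 ^ 2" where
  "Fbar_inf t a1 a2 \<chi>1 \<theta>1 = mat2 (\<chi>1 * t * a1 * a2 / \<theta>1) 0 0 1"

definition Fbar1 where
  "Fbar1 q t a1 a2 a3 a4 \<chi>1 \<chi>2 \<theta>1 \<theta>2 y z =
    (let f1 = b1_1 q t a1 a2 a3 a4 \<chi>1 \<chi>2 \<theta>1 \<theta>2 y z;
         f2 = q * \<chi>1 * \<chi>2 * a2 * (y - a3) * (y - a4) * z
              - (y - t * a2) * (a2 * \<chi>2 * y - \<theta>1);
         f3 = q * (y * a2 * \<chi>1 - \<theta>1) * z - a2 * (y - t * a1)
     in mscale (a1 / (q * y * z * \<theta>1 * (a1 - a2) * (\<theta>1 - \<chi>1 * t * a1 * a2)))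
          (mat2 (- ((y - t * a1) * f1 * a2^2)) (- (f2 * (y - t * a1) * a2))
                (f1 * f3 * a2)                 (f2 * f3)))"

definition Fbar2 where
  "Fbar2 q t a1 a2 a3 a4 \<chi>1 \<chi>2 \<theta>1 \<theta>2 y z = Fbar1 q t a2 a1 a3 a4 \<chi>1 \<chi>2 \<theta>1 \<theta>2 y z"

text \<open>Rows and columns of a \<open>6 \<times> 6\<close> matrix are indexed by pairs (block, position in the block).
  The blocks are numbered \<open>1, 2, 3\<close> and belong to the points \<open>b\<^sub>0 = 0\<close>, \<open>b\<^sub>1 = t a\<^sub>1\<close>, \<open>b\<^sub>2 = t a\<^sub>2\<close>
  in this order.\<close>

definition blocks :: "complex ^ 2 ^ 2 ^ 3 ^ 3 \<Rightarrow> complex ^ (3 \<times> 2) ^ (3 \<times> 2)" where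
  "blocks M = (\<chi> r c. M $ fst r $ fst c $ snd r $ snd c)"

text \<open>In \<open>conv1\<close> and \<open>conv2\<close> the argument \<open>ql\<close> stands for \<open>q powr lam\<close>.\<close>

definition conv1 :: "complex \<Rightarrow> complex ^ 2 ^ 2 \<Rightarrow> complex ^ 2 ^ 2 \<Rightarrow> complex ^ 2 ^ 2 \<Rightarrow>
    complex ^ (3 \<times> 2) ^ (3 \<times> 2)" where
  "conv1 ql M0 M1 M2 =
     blocks (vector [vector [0, 0, 0],
                     vector [M0, M1 - mat (1 - ql), M2],
                     vector [0, 0, 0]])"

definition conv2 :: "complex \<Rightarrow> complex ^ 2 ^ 2 \<Rightarrow> complex ^ 2 ^ 2 \<Rightarrow> complex ^ 2 ^ 2 \<Rightarrow>
    complex ^ (3 \<times> 2) ^ (3 \<times> 2)" where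
  "conv2 ql M0 M1 M2 =
     blocks (vector [vector [0, 0, 0],
                     vector [0, 0, 0],
                     vector [M0, M1, M2 - mat (1 - ql)]])"

definition conv_inf :: "complex ^ 2 ^ 2 \<Rightarrow> complex ^ 2 ^ 2 \<Rightarrow> complex ^ 2 ^ 2 \<Rightarrow>
    complex ^ (3 \<times> 2) ^ (3 \<times> 2)" where
  "conv_inf M0 M1 M2 =
     mat 1 - blocks (vector [vector [M0, M1, M2],
                             vector [M0, M1, M2],
                             vector [M0, M1, M2]])"

definition Yhat_integrand :: "complex \<Rightarrow> complex \<Rightarrow> complex ^ 3 \<Rightarrow> (complex \<Rightarrow> complex ^ 2) \<Rightarrow>
    complex \<Rightarrow> 3 \<times> 2 \<Rightarrow> complex \<Rightarrow> complex" where
  "Yhat_integrand q lam b Y x r s =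
     kernelP q lam x s / (s - b $ fst r) * (Y s $ snd r)"

definition Yhat :: "complex \<Rightarrow> complex \<Rightarrow> complex \<Rightarrow> complex ^ 3 \<Rightarrow> (complex \<Rightarrow> complex ^ 2) \<Rightarrow>
    complex \<Rightarrow> complex ^ (3 \<times> 2)" where
  "Yhat q lam \<xi> b Y x = (\<chi> r. jackson_integral q \<xi> (Yhat_integrand q lam b Y x r))"

definition ycheck1_integrand :: "complex \<Rightarrow> complex \<Rightarrow> (complex \<Rightarrow> complex ^ 2) \<Rightarrow>
    complex \<Rightarrow> complex \<Rightarrow> complex" where
  "ycheck1_integrand q lam Y x s = (Y s $ 1) / (s - x) * kernelP q lam x s"

definition ycheck2_integrand :: "complex \<Rightarrow> complex \<Rightarrow> complex \<Rightarrow> complex \<Rightarrow> complex \<Rightarrow> complex \<Rightarrow>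
    complex \<Rightarrow> complex \<Rightarrow> complex \<Rightarrow> complex \<Rightarrow> (complex \<Rightarrow> complex ^ 2) \<Rightarrow>
    complex \<Rightarrow> complex \<Rightarrow> complex" where
  "ycheck2_integrand q t a1 a2 \<chi>1 \<chi>2 \<theta>1 y z lam Y x s =
     (q * z * \<theta>1 / (s - q * y) - t * a1 * a2 / (s - y)
      + ((q * z * \<theta>1 - t * a1 * a2) / (\<chi>1 * t * a1 * a2 - \<theta>1) - q^2 * y * z / (s - q * y))
        * ((\<chi>2 * t * a1 * a2 - \<theta>1) / (x - s)))
     * (Y s $ 1) * kernelP q lam x s"

definition Ybar :: "complex \<Rightarrow> complex \<Rightarrow> complex \<Rightarrow> complex \<Rightarrow> complex \<Rightarrow> complex \<Rightarrow>
    complex \<Rightarrow> complex \<Rightarrow> complex \<Rightarrow> complex \<Rightarrow> complex \<Rightarrow> complex \<Rightarrow> (complex \<Rightarrow> complex ^ 2) \<Rightarrow>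
    complex \<Rightarrow> complex ^ 2" where
  "Ybar q t a1 a2 \<chi>1 \<chi>2 \<theta>1 w y z lam \<xi> Y x = vector
     [t * (\<chi>2 * t * a1 * a2 - \<theta>1) / (q * w * y * z * \<chi>2 * (\<chi>1 * t * a1 * a2 - \<theta>1))
        * jackson_integral q \<xi> (ycheck1_integrand q lam Y x),
      1 / (q * w * y * z * \<chi>2 * a1 * a2)
        * jackson_integral q \<xi> (ycheck2_integrand q t a1 a2 \<chi>1 \<chi>2 \<theta>1 y z lam Y x)]"

end

theory Submission
  imports Defs
begin

text \<open>
  Let \<open>U\<^sub>i\<close> be the \<open>i\<close>-th block of \<open>Yhat\<close> and \<open>V = B\<^sub>0 U\<^sub>0 + B\<^sub>1 U\<^sub>1 + B\<^sub>2 U\<^sub>2\<close>. The matrices \<open>B\<^sub>1\<close>, \<open>B\<^sub>2\<close> have rank one,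
  \<open>B\<^sub>i v = \<phi>\<^sub>i(v) u\<^sub>i\<close>, so with \<open>g\<^sub>i = \<phi>\<^sub>i(U\<^sub>i)\<close> and \<open>h\<^sub>i = \<phi>\<^sub>i(V) - (1 - q\<^sup>\<lambda>) g\<^sub>i\<close> the convolution equation gives
  \<open>V(qx) = B\<^sub>\<infinity> V + \<Sum> h\<^sub>i u\<^sub>i / (1 - x/b\<^sub>i)\<close> and \<open>g\<^sub>i(qx) = g\<^sub>i - \<phi>\<^sub>i(V) + h\<^sub>i / (1 - x/b\<^sub>i)\<close>.
  Also \<open>B\<^sub>0\<close> is singular, and pairing \<open>V\<close> with a covector that annihilates \<open>B\<^sub>0\<close> expresses \<open>V\<^sub>2\<close> by
  \<open>V\<^sub>1, g\<^sub>1, g\<^sub>2\<close>; because \<open>q\<^sup>\<lambda>\<close> is an eigenvalue of \<open>B\<^sub>\<infinity>\<close>, the \<open>h\<^sub>i\<close> then depend on \<open>V\<^sub>1\<close> and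
  \<open>g\<^sub>1 - g\<^sub>2\<close> only. Hence the span of \<open>V\<^sub>1\<close> and \<open>g\<^sub>1 - g\<^sub>2\<close> is closed under \<open>x \<mapsto> qx\<close>, and \<open>Ybar\<close> is a basis of
  it: the substitution \<open>s \<mapsto> s/q\<close> in the Jackson integral and the equation for \<open>Y\<close> turn
  \<open>V\<^sub>1\<close> into a multiple of the integral of \<open>y\<^sub>1 P / (s - x)\<close>, and \<open>g\<^sub>1 - g\<^sub>2\<close> into an integral of \<open>y\<^sub>1 P\<close>
  with poles at \<open>y\<close> and \<open>qy\<close>.
\<close>

subsection \<open>The kernel and the Jackson integral\<close>

lemma power_powr_complex:
  fixes q lam :: complex
  assumes "q \<noteq> 0"
  shows "q powr (of_nat i + lam + 1) = q powr lam * q ^ (i + 1)"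
  using assms by (simp add: powr_add powr_nat')

text \<open>Each factor differs from 1 by a bounded multiple of \<open>q ^ i\<close>, so the product
  converges absolutely. This is what identifies \<open>prodinf\<close>, a default value in the
  divergent case, with the limit of the partial products.\<close>

lemma kernelP_LIMSEQ:
  fixes q lam x s :: complex
  assumes q: "q \<noteq> 0" "norm q < 1" and x: "x \<noteq> 0" and den: "\<And>i. x \<noteq> q ^ (i + 1) * s"
  shows "(\<lambda>n. \<Prod>i\<le>n. (x - q powr lam * q ^ (i + 1) * s) / (x - q ^ (i + 1) * s))
           \<longlonglongrightarrow> kernelP q lam x s"
proof -
  let ?f = "\<lambda>i. (x - q powr lam * q ^ (i + 1) * s) / (x - q ^ (i + 1) * s)"
  \<comment> \<open>The reciprocals of the denominators converge to \<open>1 / x\<close> and are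
    therefore bounded.\<close>
  have "(\<lambda>i. 1 / (x - q ^ (i + 1) * s)) \<longlonglongrightarrow> 1 / (x - 0 * s)"
    using q x by (intro tendsto_intros LIMSEQ_ignore_initial_segment LIMSEQ_power_zero) auto
  then have "Bseq (\<lambda>i. 1 / (x - q ^ (i + 1) * s))"
    by (intro convergent_imp_Bseq convergentI)
  then obtain K where K: "\<And>i. norm (1 / (x - q ^ (i + 1) * s)) \<le> K"
    unfolding Bseq_def by auto
  have f: "?f i - 1 = (1 - q powr lam) * q * s * (1 / (x - q ^ (i + 1) * s)) * q ^ i" for i
    using den[of i] by (simp add: divide_simps) (simp add: algebra_simps)
  have le: "norm (norm (?f i - 1)) \<le> norm ((1 - q powr lam) * q * s) * K * norm q ^ i" for i
    unfolding f norm_mult norm_power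
    using mult_left_mono[OF K[of i], of "norm ((1 - q powr lam) * q * s)"]
    by (auto intro!: mult_right_mono simp: norm_mult)
  have "summable (\<lambda>i. norm (?f i - 1))"
    by (rule summable_comparison_test'[OF _ le])
       (use q in \<open>auto intro!: summable_mult summable_geometric\<close>)
  then have "convergent_prod ?f"
    by (intro abs_convergent_prod_imp_convergent_prod summable_imp_abs_convergent_prod)
  then have "(\<lambda>n. \<Prod>i\<le>n. ?f i) \<longlonglongrightarrow> prodinf ?f"
    by (rule convergent_prod_LIMSEQ)
  then show ?thesis
    by (simp add: kernelP_def power_powr_complex[OF q(1), simplified])
qed

text \<open>The factors at \<open>q * s\<close> are those at \<open>s\<close> with the index moved
  by one, so the factor \<open>i = 0\<close> splits off in every partial product.\<close>

lemma kernelP_shift: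
  fixes q lam x s :: complex
  assumes q: "q \<noteq> 0" "norm q < 1" and x: "x \<noteq> 0" and den: "\<And>i. x \<noteq> q ^ (i + 1) * s"
  shows "kernelP q lam x s = (x - q powr lam * (q * s)) / (x - q * s) * kernelP q lam x (q * s)"
proof (rule LIMSEQ_unique)
  let ?f = "\<lambda>s i. (x - q powr lam * q ^ (i + 1) * s) / (x - q ^ (i + 1) * s)"
  have "x \<noteq> q ^ (i + 1) * (q * s)" for i
    using den[of "i + 1"] by (simp add: ac_simps)
  then have "(\<lambda>n. ?f s 0 * (\<Prod>i\<le>n. ?f (q * s) i)) \<longlonglongrightarrow> ?f s 0 * kernelP q lam x (q * s)"
    by (intro tendsto_mult_left kernelP_LIMSEQ q x)
  also have "(\<lambda>n. ?f s 0 * (\<Prod>i\<le>n. ?f (q * s) i)) = (\<lambda>n. \<Prod>i\<le>Suc n. ?f s i)"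
    by (subst prod.atMost_Suc_shift) (simp add: ac_simps)
  finally show "(\<lambda>n. \<Prod>i\<le>Suc n. ?f s i) \<longlonglongrightarrow>
      (x - q powr lam * (q * s)) / (x - q * s) * kernelP q lam x (q * s)"
    by (simp add: ac_simps)
  show "(\<lambda>n. \<Prod>i\<le>Suc n. ?f s i) \<longlonglongrightarrow> kernelP q lam x s"
    by (rule LIMSEQ_Suc[OF kernelP_LIMSEQ[OF q x den]])
qed

section \<open>The lattice of sample points\<close>

lemma q_lattice_base: "q powi n * \<xi> \<in> q_lattice q \<xi>"
  unfolding q_lattice_def by blast

lemma q_lattice_mult_iff:
  assumes "q \<noteq> 0"
  shows "q * s \<in> q_lattice q \<xi> \<longleftrightarrow> s \<in> q_lattice q \<xi>"
proof
  assume "q * s \<in> q_lattice q \<xi>"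
  then obtain n where "q * s = q powi n * \<xi>" by (auto simp: q_lattice_def)
  then have "s = q powi (n - 1) * \<xi>"
    using assms by (simp add: power_int_diff field_simps)
  then show "s \<in> q_lattice q \<xi>" by (metis q_lattice_base)
next
  assume "s \<in> q_lattice q \<xi>"
  then obtain n where "s = q powi n * \<xi>" by (auto simp: q_lattice_def)
  then have "q * s = q powi (n + 1) * \<xi>"
    using assms by (simp add: power_int_add)
  then show "q * s \<in> q_lattice q \<xi>" by (metis q_lattice_base)
qed

lemma q_lattice_power_mult_iff:
  assumes "q \<noteq> 0"
  shows "q ^ i * s \<in> q_lattice q \<xi> \<longleftrightarrow> s \<in> q_lattice q \<xi>"
proof (induction i)
  case (Suc i)
  then show ?case
    using q_lattice_mult_iff[OF assms, of "q ^ i * s"] by (simp add: ac_simps)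
qed simp

lemma q_lattice_nonzero: "q \<noteq> 0 \<Longrightarrow> \<xi> \<noteq> 0 \<Longrightarrow> s \<in> q_lattice q \<xi> \<Longrightarrow> s \<noteq> 0"
  by (auto simp: q_lattice_def)

text \<open>Carries the equation for \<open>Y\<close>, posed on a set \<open>D\<close> invariant
  under multiplication by \<open>q\<close>, to all sample points. The induction runs from exponent 0
  in both directions.\<close>

lemma q_lattice_subset:
  assumes "q \<noteq> 0" "\<xi> \<in> D" "\<And>s. q * s \<in> D \<longleftrightarrow> s \<in> D"
  shows "q_lattice q \<xi> \<subseteq> D"
proof -
  have "q powi n * \<xi> \<in> D" for n
  proof (induction n rule: int_induct[where k = 0])
    case (step1 i)
    then show ?case using assms(1) assms(3)[of "q powi i * \<xi>"] by (simp add: power_int_add ac_simps)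
  next
    case (step2 i)
    then show ?case
      using assms(1) assms(3)[of "q powi (i - 1) * \<xi>"] by (simp add: power_int_diff)
  qed (use assms in simp)
  then show ?thesis by (auto simp: q_lattice_def)
qed

section \<open>Linearity, comparison and shifts for Jackson integrals\<close>

lemma jackson_integral_cong:
  "(\<And>s. s \<in> q_lattice q \<xi> \<Longrightarrow> f s = g s) \<Longrightarrow> jackson_integral q \<xi> f = jackson_integral q \<xi> g"
  unfolding jackson_integral_def q_lattice_def
  by (intro arg_cong2[where f = "(*)"] infsum_cong) auto

lemma jackson_abs_convergent_cong:
  "(\<And>s. s \<in> q_lattice q \<xi> \<Longrightarrow> f s = g s) \<Longrightarrow>
    jackson_abs_convergent q \<xi> f \<longleftrightarrow> jackson_abs_convergent q \<xi> g"
  unfolding jackson_abs_convergent_def q_lattice_def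
  by (intro summable_on_cong arg_cong[where f = norm] arg_cong2[where f = "(*)"]) auto

lemma jackson_abs_convergent_summable:
  "jackson_abs_convergent q \<xi> f \<Longrightarrow> (\<lambda>n::int. q powi n * \<xi> * f (q powi n * \<xi>)) summable_on UNIV"
  unfolding jackson_abs_convergent_def by (rule abs_summable_summable)

lemma jackson_abs_convergent_bound:
  assumes "jackson_abs_convergent q \<xi> f"
    and "\<And>s. s \<in> q_lattice q \<xi> \<Longrightarrow> norm (g s) \<le> K * norm (f s)"
  shows "jackson_abs_convergent q \<xi> g"
  unfolding jackson_abs_convergent_def
proof (rule summable_on_comparison_test)
  show "(\<lambda>n::int. K * norm (q powi n * \<xi> * f (q powi n * \<xi>))) summable_on UNIV"
    using assms(1) unfolding jackson_abs_convergent_def by (rule summable_on_cmult_right)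
  show "norm (q powi n * \<xi> * g (q powi n * \<xi>)) \<le> K * norm (q powi n * \<xi> * f (q powi n * \<xi>))"
    for n :: int
    using mult_left_mono[OF assms(2)[OF q_lattice_base, of n], of "norm (q powi n * \<xi>)"]
    by (simp add: norm_mult ac_simps)
qed simp

lemma jackson_abs_convergent_cmult:
  "jackson_abs_convergent q \<xi> f \<Longrightarrow> jackson_abs_convergent q \<xi> (\<lambda>s. c * f s)"
  by (rule jackson_abs_convergent_bound[where K = "norm c" and f = f]) (auto simp: norm_mult)

lemma jackson_abs_convergent_add:
  assumes "jackson_abs_convergent q \<xi> f" "jackson_abs_convergent q \<xi> g"
  shows "jackson_abs_convergent q \<xi> (\<lambda>s. f s + g s)"
  unfolding jackson_abs_convergent_def
proof (rule summable_on_comparison_test)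
  show "(\<lambda>n::int. norm (q powi n * \<xi> * f (q powi n * \<xi>))
      + norm (q powi n * \<xi> * g (q powi n * \<xi>))) summable_on UNIV"
    using assms unfolding jackson_abs_convergent_def by (rule summable_on_add)
qed (simp_all add: distrib_left norm_triangle_ineq)

lemma jackson_abs_convergent_diff:
  assumes "jackson_abs_convergent q \<xi> f" "jackson_abs_convergent q \<xi> g"
  shows "jackson_abs_convergent q \<xi> (\<lambda>s. f s - g s)"
  using jackson_abs_convergent_add[OF assms(1) jackson_abs_convergent_cmult[OF assms(2), of "-1"]]
  by simp

lemma jackson_integral_cmult: "jackson_integral q \<xi> (\<lambda>s. c * f s) = c * jackson_integral q \<xi> f"
proof -
  \<comment> \<open>This is unconditional: for \<open>c \<noteq> 0\<close> either both series are
    summable or both sums have the default value 0.\<close>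
  have "(\<Sum>\<^sub>\<infinity>n\<in>(UNIV :: int set). q powi n * \<xi> * (c * f (q powi n * \<xi>)))
      = c * (\<Sum>\<^sub>\<infinity>n\<in>(UNIV :: int set). q powi n * \<xi> * f (q powi n * \<xi>))"
    by (subst infsum_cmult_right'[symmetric]) (simp add: ac_simps)
  then show ?thesis by (simp add: jackson_integral_def)
qed

lemma jackson_integral_add:
  assumes "jackson_abs_convergent q \<xi> f" "jackson_abs_convergent q \<xi> g"
  shows "jackson_integral q \<xi> (\<lambda>s. f s + g s) = jackson_integral q \<xi> f + jackson_integral q \<xi> g"
  using infsum_add[OF assms[THEN jackson_abs_convergent_summable]]
  by (simp add: jackson_integral_def ring_distribs)

lemma jackson_integral_diff:
  assumes "jackson_abs_convergent q \<xi> f" "jackson_abs_convergent q \<xi> g"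
  shows "jackson_integral q \<xi> (\<lambda>s. f s - g s) = jackson_integral q \<xi> f - jackson_integral q \<xi> g"
  using jackson_integral_add[OF assms(1) jackson_abs_convergent_cmult[OF assms(2), of "-1"]]
  by (simp add: jackson_integral_cmult[of _ _ "-1", simplified])

lemma bij_int_Suc: "bij_betw (\<lambda>n::int. n + 1) UNIV UNIV"
  by (rule bij_betw_byWitness[where f' = "\<lambda>n. n - 1"]) auto

text \<open>Reindexing of the bilateral sum by \<open>n \<mapsto> n + 1\<close>; the factor
  \<open>q\<close> comes from the weight \<open>q powi n * \<xi>\<close>.\<close>

lemma jackson_integral_shift:
  assumes "q \<noteq> 0"
  shows "jackson_integral q \<xi> f = q * jackson_integral q \<xi> (\<lambda>s. f (q * s))"
proof -
  have "(\<Sum>\<^sub>\<infinity>n\<in>(UNIV :: int set). q powi n * \<xi> * f (q powi n * \<xi>))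
      = (\<Sum>\<^sub>\<infinity>n\<in>(UNIV :: int set). q powi (n + 1) * \<xi> * f (q powi (n + 1) * \<xi>))"
    by (rule infsum_reindex_bij_betw[OF bij_int_Suc, symmetric])
  also have "\<dots> = q * (\<Sum>\<^sub>\<infinity>n\<in>(UNIV :: int set). q powi n * \<xi> * f (q * (q powi n * \<xi>)))"
    using assms by (subst infsum_cmult_right'[symmetric]) (simp add: power_int_add ac_simps)
  finally show ?thesis by (simp add: jackson_integral_def)
qed

lemma jackson_abs_convergent_shift:
  assumes "q \<noteq> 0" "jackson_abs_convergent q \<xi> (\<lambda>s. f (q * s))"
  shows "jackson_abs_convergent q \<xi> f"
proof -
  have "(\<lambda>n::int. norm q * norm (q powi n * \<xi> * f (q * (q powi n * \<xi>)))) summable_on UNIV"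
    using assms(2) unfolding jackson_abs_convergent_def by (rule summable_on_cmult_right)
  moreover have "norm q * norm (q powi n * \<xi> * f (q * (q powi n * \<xi>)))
      = norm (q powi (n + 1) * \<xi> * f (q powi (n + 1) * \<xi>))" for n
    using assms(1) by (simp add: power_int_add norm_mult ac_simps)
  ultimately have "(\<lambda>n::int. norm (q powi (n + 1) * \<xi> * f (q powi (n + 1) * \<xi>))) summable_on UNIV"
    by simp
  then show ?thesis
    unfolding jackson_abs_convergent_def by (subst (asm) summable_on_reindex_bij_betw[OF bij_int_Suc])
qed

text \<open>Substituting \<open>s \<mapsto> s / q\<close> moves the factor \<open>(x - q\<^sup>\<lambda> s) / (x - s)\<close> out of the kernel.\<close>

lemma jackson_kernel_shift:
  assumes q: "q \<noteq> 0" "norm q < 1" and x: "x \<noteq> 0" "x \<notin> q_lattice q \<xi>"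
    and conv: "jackson_abs_convergent q \<xi> (\<lambda>s. kernelP q lam x s * g (q * s))"
  shows "jackson_abs_convergent q \<xi> (\<lambda>s. (x - q powr lam * s) / (x - s) * kernelP q lam x s * g s)"
    and "jackson_integral q \<xi> (\<lambda>s. (x - q powr lam * s) / (x - s) * kernelP q lam x s * g s)
      = q * jackson_integral q \<xi> (\<lambda>s. kernelP q lam x s * g (q * s))"
proof -
  let ?h = "\<lambda>s. (x - q powr lam * s) / (x - s) * kernelP q lam x s * g s"
  \<comment> \<open>At \<open>q * s\<close> the factor in front is exactly the one that
    \<open>kernelP_shift\<close> splits off. Its denominators are nonzero because \<open>x\<close>
    is off the lattice.\<close>
  have h: "?h (q * s) = kernelP q lam x s * g (q * s)" if "s \<in> q_lattice q \<xi>" for s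
  proof -
    have "x \<noteq> q ^ (i + 1) * s" for i
      using that x(2) q_lattice_power_mult_iff[OF q(1), of "i + 1" s \<xi>] by metis
    then show ?thesis
      using kernelP_shift[OF q x(1), of s lam] by simp
  qed
  show "jackson_abs_convergent q \<xi> ?h"
  proof (rule jackson_abs_convergent_shift[OF q(1)])
    show "jackson_abs_convergent q \<xi> (\<lambda>s. ?h (q * s))"
      using conv jackson_abs_convergent_cong[of q \<xi> "\<lambda>s. ?h (q * s)", OF h] by simp
  qed
  show "jackson_integral q \<xi> ?h = q * jackson_integral q \<xi> (\<lambda>s. kernelP q lam x s * g (q * s))"
    unfolding jackson_integral_shift[OF q(1), of \<xi> ?h]
    using jackson_integral_cong[of q \<xi> "\<lambda>s. ?h (q * s)", OF h] by simp
qed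

text \<open>The ratio tends to 0 as \<open>n \<rightarrow> \<infinity>\<close>, where
  \<open>s \<rightarrow> 0\<close>, and to 1 as \<open>n \<rightarrow> -\<infinity>\<close>, where
  \<open>s \<rightarrow> \<infinity>\<close>. Each half of the lattice thus gives a convergent,
  hence bounded, sequence.\<close>

lemma q_lattice_ratio_bounded:
  assumes q: "q \<noteq> 0" "norm q < 1" and \<xi>: "\<xi> \<noteq> 0" and y: "y \<noteq> 0" "y \<notin> q_lattice q \<xi>"
  obtains K where "\<And>s. s \<in> q_lattice q \<xi> \<Longrightarrow> norm (s / (s - y)) \<le> K"
proof -
  have "(\<lambda>n. q ^ n * \<xi> / (q ^ n * \<xi> - y)) \<longlonglongrightarrow> 0 * \<xi> / (0 * \<xi> - y)"
    using q y by (intro tendsto_intros LIMSEQ_power_zero) auto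
  then have "Bseq (\<lambda>n. q ^ n * \<xi> / (q ^ n * \<xi> - y))"
    by (intro convergent_imp_Bseq convergentI)
  then obtain K1 where K1: "\<And>n. norm (q ^ n * \<xi> / (q ^ n * \<xi> - y)) \<le> K1"
    unfolding Bseq_def by auto
  have "(\<lambda>n. \<xi> / (\<xi> - y * q ^ n)) \<longlonglongrightarrow> \<xi> / (\<xi> - y * 0)"
    using q \<xi> by (intro tendsto_intros LIMSEQ_power_zero) auto
  then have "Bseq (\<lambda>n. \<xi> / (\<xi> - y * q ^ n))"
    by (intro convergent_imp_Bseq convergentI)
  then obtain K2 where K2: "\<And>n. norm (\<xi> / (\<xi> - y * q ^ n)) \<le> K2"
    unfolding Bseq_def by auto
  have "norm (s / (s - y)) \<le> max K1 K2" if "s \<in> q_lattice q \<xi>" for s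
  proof -
    from that obtain n :: int where s: "s = q powi n * \<xi>"
      by (auto simp: q_lattice_def)
    show ?thesis
    proof (cases n)
      case (nonneg m)
      then show ?thesis using K1[of m] by (simp add: s)
    next
      case (neg m)
      \<comment> \<open>Here \<open>n = - Suc m\<close>; numerator and denominator are multiplied by
        \<open>q ^ Suc m\<close>.\<close>
      have "s / (s - y) = \<xi> / (\<xi> - y * q ^ Suc m)"
        using q(1) by (simp add: s neg power_int_minus field_simps del: of_nat_Suc power_Suc)
      then show ?thesis using K2[of "Suc m"] by simp
    qed
  qed
  then show ?thesis using that by blast
qed

text \<open>By \<open>step\<close> and \<open>1 / s - 1 / (s - b) = 1 / (s * (1 - s / b))\<close>,
  the integrands on the left add up to \<open>P s * (u s - u (q * s)) / s\<close>. Shifting the part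
  with \<open>u (q * s)\<close> leaves the factor
  \<open>1 - (x - q\<^sup>\<lambda> s) / (x - s)\<close>, which replaces the pole at 0 by one at
  \<open>x\<close>.\<close>

lemma jackson_telescope:
  fixes q lam x \<xi> b1 b2 e r1 r2 :: complex and u G1 G2 :: "complex \<Rightarrow> complex"
  defines "P \<equiv> kernelP q lam x"
  assumes q: "q \<noteq> 0" "norm q < 1" and \<xi>: "\<xi> \<noteq> 0" and x: "x \<noteq> 0" "x \<notin> q_lattice q \<xi>"
    and b: "b1 \<noteq> 0" "b2 \<noteq> 0" "b1 \<notin> q_lattice q \<xi>" "b2 \<notin> q_lattice q \<xi>"
    and step: "\<And>s. s \<in> q_lattice q \<xi> \<Longrightarrow>
      u (q * s) = e * u s + r1 * G1 s / (1 - s / b1) + r2 * G2 s / (1 - s / b2)"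
    and conv0: "jackson_abs_convergent q \<xi> (\<lambda>s. P s * u s / s)"
      "jackson_abs_convergent q \<xi> (\<lambda>s. P s * G1 s / s)"
      "jackson_abs_convergent q \<xi> (\<lambda>s. P s * G2 s / s)"
    and conv1: "jackson_abs_convergent q \<xi> (\<lambda>s. P s * G1 s / (s - b1))"
    and conv2: "jackson_abs_convergent q \<xi> (\<lambda>s. P s * G2 s / (s - b2))"
  shows "(1 - e) * jackson_integral q \<xi> (\<lambda>s. P s * u s / s)
      - r1 * jackson_integral q \<xi> (\<lambda>s. P s * G1 s / s)
      - r2 * jackson_integral q \<xi> (\<lambda>s. P s * G2 s / s)
      + r1 * jackson_integral q \<xi> (\<lambda>s. P s * G1 s / (s - b1))
      + r2 * jackson_integral q \<xi> (\<lambda>s. P s * G2 s / (s - b2))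
    = (1 - q powr lam) * jackson_integral q \<xi> (\<lambda>s. u s / (s - x) * P s)"
proof -
  let ?J = "jackson_integral q \<xi>"
  define F where "F = (\<lambda>s. (1 - e) * (P s * u s / s) - r1 * (P s * G1 s / s) - r2 * (P s * G2 s / s)
      + r1 * (P s * G1 s / (s - b1)) + r2 * (P s * G2 s / (s - b2)))"
  have convF: "jackson_abs_convergent q \<xi> F"
    unfolding F_def
    by (intro jackson_abs_convergent_add jackson_abs_convergent_diff jackson_abs_convergent_cmult
        conv0 conv1 conv2)
  have JF: "?J F = (1 - e) * ?J (\<lambda>s. P s * u s / s) - r1 * ?J (\<lambda>s. P s * G1 s / s)
      - r2 * ?J (\<lambda>s. P s * G2 s / s) + r1 * ?J (\<lambda>s. P s * G1 s / (s - b1))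
      + r2 * ?J (\<lambda>s. P s * G2 s / (s - b2))"
    unfolding F_def
    by (simp only: jackson_integral_add jackson_integral_diff jackson_integral_cmult
        jackson_abs_convergent_add jackson_abs_convergent_diff jackson_abs_convergent_cmult
        conv0 conv1 conv2)
  have split: "1 / s - 1 / (s - d) = (1 / (1 - s / d)) / s"
    if "d \<noteq> 0" "s \<noteq> 0" "s \<noteq> d" for s d :: complex
    using that by (simp add: divide_simps) (simp add: algebra_simps)
  have F: "P s * (u (q * s) / (q * s)) = (P s * u s / s - F s) / q" if "s \<in> q_lattice q \<xi>" for s
  proof -
    have s: "s \<noteq> 0" "s \<noteq> b1" "s \<noteq> b2"
      using that b q_lattice_nonzero[OF q(1) \<xi>] by auto
    have "F s = P s * ((1 - e) * u s / s - r1 * G1 s * (1 / s - 1 / (s - b1))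
        - r2 * G2 s * (1 / s - 1 / (s - b2)))"
      by (simp add: F_def algebra_simps diff_divide_distrib)
    also have "\<dots> = P s * (u s - u (q * s)) / s"
      unfolding split[OF b(1) s(1,2)] split[OF b(2) s(1,3)] step[OF that]
      using s by (simp add: add_divide_distrib diff_divide_distrib algebra_simps)
    finally show ?thesis using s q by (simp add: field_simps)
  qed
  \<comment> \<open>The identity \<open>F\<close> exhibits this integrand as a combination of two
    convergent ones.\<close>
  have conv_shift: "jackson_abs_convergent q \<xi> (\<lambda>s. P s * (u (q * s) / (q * s)))"
    using jackson_abs_convergent_cmult[OF jackson_abs_convergent_diff[OF conv0(1) convF], of "1 / q"]
    by (subst jackson_abs_convergent_cong[OF F]) auto
  note shift = jackson_kernel_shift[OF q x, of lam "\<lambda>s. u s / s", folded P_def, OF conv_shift]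
  have "?J (\<lambda>s. P s * (u (q * s) / (q * s))) = (?J (\<lambda>s. P s * u s / s) - ?J F) / q"
    using jackson_integral_cong[OF F] jackson_integral_cmult[of q \<xi> "1 / q"]
      jackson_integral_diff[OF conv0(1) convF]
    by simp
  with shift(2) have "?J F = ?J (\<lambda>s. P s * u s / s)
      - ?J (\<lambda>s. (x - q powr lam * s) / (x - s) * P s * (u s / s))"
    using q by simp
  also have "\<dots> = ?J (\<lambda>s. P s * u s / s - (x - q powr lam * s) / (x - s) * P s * (u s / s))"
    by (rule jackson_integral_diff[OF conv0(1) shift(1), symmetric])
  also have "\<dots> = ?J (\<lambda>s. (1 - q powr lam) * (u s / (s - x) * P s))"
  proof (rule jackson_integral_cong)
    fix s assume "s \<in> q_lattice q \<xi>"
    then have "s \<noteq> 0" "s \<noteq> x" "x \<noteq> s"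
      using x q_lattice_nonzero[OF q(1) \<xi>] by auto
    then show "P s * u s / s - (x - q powr lam * s) / (x - s) * P s * (u s / s)
        = (1 - q powr lam) * (u s / (s - x) * P s)"
      by (simp add: divide_simps) (simp add: algebra_simps)
  qed
  finally show ?thesis
    unfolding JF jackson_integral_cmult .
qed

text \<open>Absolute convergence of the two parts of the integrand is inherited from that of
  \<open>P u / s\<close>, because \<open>s / (s - y)\<close> is bounded on the lattice.\<close>

lemma jackson_pole_shift:
  fixes q lam x \<xi> b1 b2 y m n C :: complex and u G1 G2 :: "complex \<Rightarrow> complex"
  defines "P \<equiv> kernelP q lam x"
  assumes q: "q \<noteq> 0" "norm q < 1" and \<xi>: "\<xi> \<noteq> 0" and x: "x \<noteq> 0" "x \<notin> q_lattice q \<xi>"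
    and y: "y \<noteq> 0" "y \<notin> q_lattice q \<xi>" and m: "m \<noteq> 0"
    and step: "\<And>s. s \<in> q_lattice q \<xi> \<Longrightarrow>
      (m * u (q * s) - n * u s) / (s - y) = C * (G1 s / (s - b1) - G2 s / (s - b2))"
    and conv0: "jackson_abs_convergent q \<xi> (\<lambda>s. P s * u s / s)"
    and conv1: "jackson_abs_convergent q \<xi> (\<lambda>s. P s * G1 s / (s - b1))"
    and conv2: "jackson_abs_convergent q \<xi> (\<lambda>s. P s * G2 s / (s - b2))"
  shows "jackson_abs_convergent q \<xi>
        (\<lambda>s. (m * ((x - q powr lam * s) / (x - s)) / (s - q * y) - n / (s - y)) * u s * P s)"
    and "jackson_integral q \<xi>
        (\<lambda>s. (m * ((x - q powr lam * s) / (x - s)) / (s - q * y) - n / (s - y)) * u s * P s)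
      = C * (jackson_integral q \<xi> (\<lambda>s. P s * G1 s / (s - b1))
             - jackson_integral q \<xi> (\<lambda>s. P s * G2 s / (s - b2)))"
proof -
  let ?J = "jackson_integral q \<xi>"
  obtain K where K: "\<And>s. s \<in> q_lattice q \<xi> \<Longrightarrow> norm (s / (s - y)) \<le> K"
    using q_lattice_ratio_bounded[OF q \<xi> y] by blast
  have conv_y: "jackson_abs_convergent q \<xi> (\<lambda>s. P s * u s / (s - y))"
  proof (rule jackson_abs_convergent_bound[OF conv0])
    fix s assume s: "s \<in> q_lattice q \<xi>"
    then have "s \<noteq> 0" using q_lattice_nonzero[OF q(1) \<xi>] by auto
    then have "norm (P s * u s / (s - y)) = norm (s / (s - y)) * norm (P s * u s / s)"
      by (simp add: norm_divide norm_mult)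
    also have "\<dots> \<le> K * norm (P s * u s / s)"
      using K[OF s] by (rule mult_right_mono) simp
    finally show "norm (P s * u s / (s - y)) \<le> K * norm (P s * u s / s)" .
  qed
  define G where "G = (\<lambda>s. C * (P s * G1 s / (s - b1) - P s * G2 s / (s - b2)))"
  have convG: "jackson_abs_convergent q \<xi> G"
    unfolding G_def
    by (intro jackson_abs_convergent_diff jackson_abs_convergent_cmult conv1 conv2)
  have JG: "?J G = C * (?J (\<lambda>s. P s * G1 s / (s - b1)) - ?J (\<lambda>s. P s * G2 s / (s - b2)))"
    unfolding G_def by (simp only: jackson_integral_diff jackson_integral_cmult conv1 conv2)
  \<comment> \<open>\<open>step\<close> solved for \<open>u (q * s)\<close>, with
    \<open>1 / (s - y)\<close> written as \<open>q / (q * s - q * y)\<close>: the integrand is then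
    a function of \<open>q * s\<close>, and the shift moves the pole from \<open>y\<close> to
    \<open>q * y\<close>.\<close>
  have key: "P s * (q * u (q * s) / (q * s - q * y)) = 1 / m * (G s + n * (P s * u s / (s - y)))"
    if "s \<in> q_lattice q \<xi>" for s
  proof -
    have s: "s \<noteq> y" using that y by auto
    have "G s = P s * (C * (G1 s / (s - b1) - G2 s / (s - b2)))"
      by (simp add: G_def algebra_simps)
    also have "\<dots> = P s * ((m * u (q * s) - n * u s) / (s - y))"
      by (simp only: step[OF that])
    finally have "G s + n * (P s * u s / (s - y)) = m * (P s * (u (q * s) / (s - y)))"
      by (simp add: diff_divide_distrib algebra_simps)
    moreover have "q * u (q * s) / (q * s - q * y) = u (q * s) / (s - y)"
      using q(1) by (simp flip: right_diff_distrib)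
    ultimately show ?thesis using m by simp
  qed
  have conv_key: "jackson_abs_convergent q \<xi> (\<lambda>s. P s * (q * u (q * s) / (q * s - q * y)))"
    by (subst jackson_abs_convergent_cong[OF key], assumption)
      (intro jackson_abs_convergent_cmult jackson_abs_convergent_add convG conv_y)
  note shift = jackson_kernel_shift[OF q x, of lam "\<lambda>s. q * u s / (s - q * y)", folded P_def, OF conv_key]
  have J_key: "m * ?J (\<lambda>s. P s * (q * u (q * s) / (q * s - q * y)))
      = ?J G + n * ?J (\<lambda>s. P s * u s / (s - y))"
    using jackson_integral_cong[OF key] m
    by (simp only: jackson_integral_cmult jackson_integral_add convG conv_y
        jackson_abs_convergent_cmult) simp
  \<comment> \<open>The weight \<open>m / q\<close> cancels the factor \<open>q\<close> that the
    shift produces.\<close>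
  let ?H = "\<lambda>s. m / q * ((x - q powr lam * s) / (x - s) * P s * (q * u s / (s - q * y)))
      - n * (P s * u s / (s - y))"
  have H: "?H = (\<lambda>s. (m * ((x - q powr lam * s) / (x - s)) / (s - q * y) - n / (s - y)) * u s * P s)"
  proof
    fix s
    have "m / q * (A * p * (q * v / B)) - n * (p * v / E) = (m * A / B - n / E) * v * p"
      for A B E p v :: complex
    proof -
      have "m / q * (A * p * (q * v / B)) = m * A / B * v * p"
        using q(1) by simp
      then show ?thesis by (simp only: left_diff_distrib) simp
    qed
    then show "?H s = (m * ((x - q powr lam * s) / (x - s)) / (s - q * y) - n / (s - y)) * u s * P s" .
  qed
  have "jackson_abs_convergent q \<xi> ?H"
    by (intro jackson_abs_convergent_diff jackson_abs_convergent_cmult shift(1) conv_y)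
  then show "jackson_abs_convergent q \<xi>
      (\<lambda>s. (m * ((x - q powr lam * s) / (x - s)) / (s - q * y) - n / (s - y)) * u s * P s)"
    by (simp only: H)
  have "?J ?H = ?J G"
    using q(1) J_key
    by (simp only: jackson_integral_diff jackson_integral_cmult jackson_abs_convergent_cmult
        shift conv_y) simp
  then show "?J (\<lambda>s. (m * ((x - q powr lam * s) / (x - s)) / (s - q * y) - n / (s - y)) * u s * P s)
      = C * (?J (\<lambda>s. P s * G1 s / (s - b1)) - ?J (\<lambda>s. P s * G2 s / (s - b2)))"
    by (simp only: H JG)
qed

subsection \<open>Block decomposition of the convolution equation\<close>

definition block :: "complex ^ (3 \<times> 2) \<Rightarrow> 3 \<Rightarrow> complex ^ 2" where
  "block W i = (\<chi> j. W $ (i, j))"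

lemma sum_UNIV_prod:
  "(\<Sum>p\<in>(UNIV :: ('a::finite \<times> 'b::finite) set). f p) = (\<Sum>i\<in>UNIV. \<Sum>j\<in>UNIV. f (i, j))"
  by (metis UNIV_Times_UNIV sum.cartesian_product')

lemma block_blocks_mult: "block (blocks M *v W) i = (\<Sum>k\<in>UNIV. M $ i $ k *v block W k)"
  by (simp add: block_def blocks_def matrix_vector_mult_def sum_UNIV_prod vec_eq_iff)

lemma block_linear:
  "block (V + W) i = block V i + block W i"
  "block (V - W) i = block V i - block W i"
  "block (c *s V) i = c *s block V i"
  by (simp_all add: block_def vec_eq_iff)

lemma mscale_mult_vec: "mscale c A *v v = c *s (A *v v)"
  by (simp add: matrix_vector_mult_def map_matrix_def vec_eq_iff sum_distrib_left ac_simps)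

lemma coeffA_mult:
  "coeffA b1 b2 Ainf A1 A2 x *v v =
     Ainf *v v + (1 / (1 - x / b1)) *s (A1 *v v) + (1 / (1 - x / b2)) *s (A2 *v v)"
  by (simp add: coeffA_def matrix_vector_mult_add_rdistrib mscale_mult_vec)

lemma mat_mult_vec: "mat c *v v = c *s (v :: complex ^ 'n)"
  by (simp add: matrix_vector_mult_def mat_def vec_eq_iff mult_delta_left)

lemma block_conv_inf:
  "block (conv_inf M0 M1 M2 *v W) i
     = block W i - (M0 *v block W 1 + M1 *v block W 2 + M2 *v block W 3)"
  using exhaust_3[of i]
  by (auto simp: conv_inf_def matrix_vector_mult_diff_rdistrib block_linear block_blocks_mult sum_3)

lemma block_conv1:
  "block (conv1 ql M0 M1 M2 *v W) i
     = (if i = 2 then M0 *v block W 1 + M1 *v block W 2 + M2 *v block W 3 - (1 - ql) *s block W 2 else 0)"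
  using exhaust_3[of i]
  by (auto simp: conv1_def matrix_vector_mult_diff_rdistrib block_blocks_mult sum_3 mat_mult_vec)

lemma block_conv2:
  "block (conv2 ql M0 M1 M2 *v W) i
     = (if i = 3 then M0 *v block W 1 + M1 *v block W 2 + M2 *v block W 3 - (1 - ql) *s block W 3 else 0)"
  using exhaust_3[of i]
  by (auto simp: conv2_def matrix_vector_mult_diff_rdistrib block_blocks_mult sum_3 mat_mult_vec)

text \<open>Up to the diagonal corrections, every nonzero block row of the convolution matrices is
  \<open>M0, M1, M2\<close>. So each block of \<open>W'\<close> involves only the same block of
  \<open>W\<close> and the common vector \<open>V\<close>.\<close>

lemma conv_step:
  fixes M0 M1 M2 :: "complex ^ 2 ^ 2" and W :: "complex ^ (3 \<times> 2)" and b1 b2 ql x :: complex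
  defines "V \<equiv> M0 *v block W 1 + M1 *v block W 2 + M2 *v block W 3"
  defines "W' \<equiv> coeffA b1 b2 (conv_inf M0 M1 M2) (conv1 ql M0 M1 M2) (conv2 ql M0 M1 M2) x *v W"
  shows "block W' 1 = block W 1 - V"
    and "block W' 2 = block W 2 - V + (1 / (1 - x / b1)) *s (V - (1 - ql) *s block W 2)"
    and "block W' 3 = block W 3 - V + (1 / (1 - x / b2)) *s (V - (1 - ql) *s block W 3)"
  by (simp_all add: W'_def V_def coeffA_mult block_linear block_conv_inf block_conv1 block_conv2)

text \<open>Linear forms pass under the integral; this is applied to the first coordinate and to the
  rows of \<open>B1\<close> and \<open>B2\<close>.\<close>

lemma Yhat_functional:
  assumes "jackson_abs_convergent q \<xi> (Yhat_integrand q lam b Y x (i, 1))"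
    and "jackson_abs_convergent q \<xi> (Yhat_integrand q lam b Y x (i, 2))"
  shows "jackson_abs_convergent q \<xi> (\<lambda>s. kernelP q lam x s * (m * Y s $ 1 + n * Y s $ 2) / (s - b $ i))"
    and "m * block (Yhat q lam \<xi> b Y x) i $ 1 + n * block (Yhat q lam \<xi> b Y x) i $ 2
      = jackson_integral q \<xi> (\<lambda>s. kernelP q lam x s * (m * Y s $ 1 + n * Y s $ 2) / (s - b $ i))"
proof -
  have eq: "(\<lambda>s. kernelP q lam x s * (m * Y s $ 1 + n * Y s $ 2) / (s - b $ i))
      = (\<lambda>s. m * Yhat_integrand q lam b Y x (i, 1) s + n * Yhat_integrand q lam b Y x (i, 2) s)"
    by (simp add: fun_eq_iff Yhat_integrand_def ring_distribs add_divide_distrib ac_simps)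
  show "jackson_abs_convergent q \<xi> (\<lambda>s. kernelP q lam x s * (m * Y s $ 1 + n * Y s $ 2) / (s - b $ i))"
    unfolding eq by (intro jackson_abs_convergent_add jackson_abs_convergent_cmult assms)
  show "m * block (Yhat q lam \<xi> b Y x) i $ 1 + n * block (Yhat q lam \<xi> b Y x) i $ 2
      = jackson_integral q \<xi> (\<lambda>s. kernelP q lam x s * (m * Y s $ 1 + n * Y s $ 2) / (s - b $ i))"
    unfolding eq
    by (simp only: jackson_integral_add jackson_integral_cmult jackson_abs_convergent_cmult assms)
       (simp add: block_def Yhat_def)
qed

subsection \<open>Reduction to a system of rank two\<close>

text \<open>\<open>a1\<close> and \<open>a2\<close> are not fixed here but passed as arguments, so
  that every fact about index 1 yields the one about index 2 by exchanging them.\<close>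

locale middle_convolution_parameters =
  fixes q t a3 a4 \<chi>1 \<chi>2 \<theta>1 \<theta>2 w y z :: complex
  assumes nonzero: "q \<noteq> 0" "t \<noteq> 0" "\<chi>1 \<noteq> 0" "\<chi>2 \<noteq> 0" "\<theta>1 \<noteq> 0" "w \<noteq> 0" "y \<noteq> 0" "z \<noteq> 0"
    and chi_distinct: "\<chi>1 \<noteq> \<chi>2"
begin

text \<open>\<open>B\<^sub>1\<close> has rank one: \<open>(bcol1, bcol2)\<close> is its column and \<open>(brow, w \<chi>\<^sub>2)\<close> its row;
  exchanging the arguments \<open>a1\<close> and \<open>a2\<close> gives the factors of \<open>B\<^sub>2\<close>.\<close>

definition brow :: "complex \<Rightarrow> complex \<Rightarrow> complex" where
  "brow a1 a2 = b1_1 q t a1 a2 a3 a4 \<chi>1 \<chi>2 \<theta>1 \<theta>2 y z / (q * y * z * (\<chi>1 - \<chi>2))"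

definition bcol1 :: "complex \<Rightarrow> complex \<Rightarrow> complex" where
  "bcol1 a1 a2 = a2 * (y - t * a1) / (t * \<theta>1 * (a1 - a2))"

definition bcol2 :: "complex \<Rightarrow> complex \<Rightarrow> complex" where
  "bcol2 a1 a2 = - (a2 * b2_1 q t a1 a2 a3 a4 \<chi>1 \<chi>2 \<theta>1 \<theta>2 y z
                 / (t * \<theta>1 * (a1 - a2) * q * w * y * z * (\<chi>1 - \<chi>2)))"

definition f2 :: "complex \<Rightarrow> complex \<Rightarrow> complex" where
  "f2 a1 a2 = q * \<chi>1 * \<chi>2 * a2 * (y - a3) * (y - a4) * z
              - (y - t * a2) * (a2 * \<chi>2 * y - \<theta>1)"

definition f3 :: "complex \<Rightarrow> complex \<Rightarrow> complex" where
  "f3 a1 a2 = q * (y * a2 * \<chi>1 - \<theta>1) * z - a2 * (y - t * a1)"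

text \<open>The coefficients in \<open>ybar = (ybar1_V V\<^sub>1, ybar2_V V\<^sub>1 + ybar2_g (g\<^sub>1 - g\<^sub>2))\<close>, and those of
  \<open>h\<^sub>1 = h_V V\<^sub>1 + h_g (g\<^sub>1 - g\<^sub>2)\<close>; see \<open>ybar\<close>, \<open>h\<close> and \<open>h_eq\<close> below.\<close>

definition ybar1_V :: "complex \<Rightarrow> complex \<Rightarrow> complex" where
  "ybar1_V a1 a2 = - t * \<theta>1 / (q * w * y * z * \<chi>2 * (\<chi>1 * t * a1 * a2 - \<theta>1))"

definition ybar2_V :: "complex \<Rightarrow> complex \<Rightarrow> complex" where
  "ybar2_V a1 a2 = t * \<theta>1 * (q * z * \<chi>1 - 1) / (q * w * y * z * \<chi>2 * (\<chi>1 * t * a1 * a2 - \<theta>1))"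

definition ybar2_g :: "complex \<Rightarrow> complex \<Rightarrow> complex" where
  "ybar2_g a1 a2 = 1 / (w * y * \<chi>2 * (a1 - a2))"

definition h_V :: "complex \<Rightarrow> complex \<Rightarrow> complex" where
  "h_V a1 a2 = - (t / (q * y * z)) * (a1 * (y - t * a2) + q * z * (\<theta>2 - a1 * \<chi>1 * y))"

definition h_g :: "complex \<Rightarrow> complex \<Rightarrow> complex" where
  "h_g a1 a2 = - (a1 * f2 a1 a2 / (\<theta>1 * y * (a1 - a2)))"

lemma B1_eq:
  "B1 q t a1 a2 a3 a4 \<chi>1 \<chi>2 \<theta>1 \<theta>2 w y z =
     mat2 (bcol1 a1 a2 * brow a1 a2) (bcol1 a1 a2 * (w * \<chi>2)) (bcol2 a1 a2 * brow a1 a2) (bcol2 a1 a2 * (w * \<chi>2))"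
  using nonzero
  by (simp add: B1_def Let_def bcol1_def bcol2_def brow_def vec_eq_iff forall_2 map_matrix_def power2_eq_square ac_simps)

section \<open>Rational identities between the coefficients\<close>

context
  fixes a1 a2 :: complex
  assumes a_nonzero: "a1 \<noteq> 0" "a2 \<noteq> 0"
    and relation: "\<chi>1 * \<chi>2 * a1 * a2 * a3 * a4 = \<theta>1 * \<theta>2"
    and generic: "a1 \<noteq> a2" "\<chi>1 * t * a1 * a2 \<noteq> \<theta>1"
begin

text \<open>The rows of \<open>B1\<close> and \<open>B2\<close> share the entry
  \<open>w * \<chi>2\<close>, so this number is all that separates \<open>\<phi>\<^sub>1\<close>
  from \<open>\<phi>\<^sub>2\<close>, and \<open>\<phi>\<^sub>1(v) - \<phi>\<^sub>2(v)\<close>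
  depends on the first component of \<open>v\<close> only.\<close>

lemma brow_diff: "brow a1 a2 - brow a2 a1 = (q * z * \<chi>1 - 1) * t * (a1 - a2) / (q * z)"
proof -
  have "b1_1 q t a1 a2 a3 a4 \<chi>1 \<chi>2 \<theta>1 \<theta>2 y z - b1_1 q t a2 a1 a3 a4 \<chi>1 \<chi>2 \<theta>1 \<theta>2 y z
    = (q * z * \<chi>1 - 1) * t * (a1 - a2) * y * (\<chi>1 - \<chi>2)"
    unfolding b1_1_def by algebra
  then show ?thesis
    using nonzero chi_distinct by (simp add: brow_def flip: diff_divide_distrib)
qed

text \<open>The covector that annihilates \<open>B\<^sub>0\<close> is therefore the same for both
  orders of the arguments.\<close>

lemma h_V_diff: "brow a1 a2 - h_V a1 a2 = brow a2 a1 - h_V a2 a1"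
proof -
  have "h_V a1 a2 - h_V a2 a1 = (q * z * \<chi>1 - 1) * t * (a1 - a2) / (q * z)"
    using nonzero unfolding h_V_def by (simp add: divide_simps) algebra
  with brow_diff show ?thesis by (simp add: algebra_simps)
qed

text \<open>The parameter relation enters through this polynomial identity; \<open>h_V_eq\<close>
  and \<open>left_null2\<close> are obtained from it by dividing out denominators.\<close>

lemma h_V_numerator:
  "a1 * (- b1_1 q t a1 a2 a3 a4 \<chi>1 \<chi>2 \<theta>1 \<theta>2 y z * a2 + f2 a1 a2 * (q * z * \<chi>1 - 1))
     = (a1 * (y - t * a2) + q * z * (\<theta>2 - a1 * \<chi>1 * y)) * (\<chi>1 * t * a1 * a2 - \<theta>1)"
  unfolding b1_1_def f2_def using relation by algebra

text \<open>With \<open>h_g_eq\<close>: written in the basis \<open>Ybar\<close>,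
  \<open>h\<^sub>1\<close> is a multiple of the row \<open>(b1_1 * a2, f2)\<close> of the rank-one
  matrix \<open>Fbar1\<close>.\<close>

lemma h_V_eq:
  "h_V a1 a2 = - (a1 * w * \<chi>2 / \<theta>1) *
     (b1_1 q t a1 a2 a3 a4 \<chi>1 \<chi>2 \<theta>1 \<theta>2 y z * a2 * ybar1_V a1 a2 + f2 a1 a2 * ybar2_V a1 a2)"
  using nonzero generic h_V_numerator unfolding h_V_def ybar1_V_def ybar2_V_def
  by (simp add: divide_simps) algebra

lemma h_g_eq: "h_g a1 a2 = - (a1 * w * \<chi>2 / \<theta>1) * f2 a1 a2 * ybar2_g a1 a2"
  using nonzero unfolding h_g_def ybar2_g_def by (simp add: divide_simps)

text \<open>Turns \<open>left_null1\<close> with exchanged arguments into the value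
  \<open>- h_g a1 a2\<close> on the column of \<open>B2\<close>. This is why
  \<open>g\<^sub>1\<close> and \<open>g\<^sub>2\<close> enter \<open>h\<^sub>1\<close> with opposite
  coefficients.\<close>

lemma h_g_swap: "h_g a2 a1 + 1 - \<chi>2 * t * a1 * a2 / \<theta>1 = - h_g a1 a2"
proof -
  have "a1 * f2 a1 a2 - a2 * f2 a2 a1 = y * (a1 - a2) * (\<theta>1 - \<chi>2 * t * a1 * a2)"
    unfolding f2_def by algebra
  then show ?thesis
    using nonzero generic unfolding h_g_def by (simp add: divide_simps) algebra
qed

text \<open>The covector \<open>(brow - h_V, w \<chi>\<^sub>2)\<close> annihilates \<open>B\<^sub>0\<close> from the left: \<open>left_null1\<close> computes its
  pairing with the column of \<open>B\<^sub>1\<close>, and \<open>left_null2\<close> is the first component of the annihilation.\<close>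

lemma left_null1:
  "(brow a1 a2 - h_V a1 a2) * bcol1 a1 a2 + w * \<chi>2 * bcol2 a1 a2 = h_g a1 a2 + 1 - \<chi>2 * t * a1 * a2 / \<theta>1"
  using nonzero chi_distinct generic
  unfolding brow_def h_V_def h_g_def bcol1_def bcol2_def b1_1_def b2_1_def f2_def
  by (simp add: divide_simps) (simp add: algebra_simps power2_eq_square)

lemma left_null2:
  "(brow a1 a2 - h_V a1 a2) * (1 - \<chi>1 * t * a1 * a2 / \<theta>1) - (1 - \<chi>2 * t * a1 * a2 / \<theta>1) * brow a1 a2
     = h_g a1 a2 * (brow a1 a2 - brow a2 a1)"
  unfolding brow_diff using nonzero chi_distinct generic h_V_numerator
  unfolding brow_def h_V_def h_g_def
  by (simp add: divide_simps) algebra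

text \<open>With \<open>Fbar_second\<close>: the column of \<open>Fbar1\<close> is, up to the scalar
  in \<open>h\<close>, the increment of \<open>ybar\<close> when \<open>V\<^sub>1\<close> grows by
  \<open>bcol1\<close> and \<open>g\<^sub>1\<close> by 1.\<close>

lemma Fbar_first: "ybar1_V a1 a2 * bcol1 a1 a2 * - (a1 * w * \<chi>2 / \<theta>1) =
  - (a1 / (q * y * z * \<theta>1 * (a1 - a2) * (\<theta>1 - \<chi>1 * t * a1 * a2)) * (y - t * a1) * a2)"
  using nonzero generic unfolding ybar1_V_def bcol1_def by (simp add: divide_simps) algebra

lemma Fbar_second: "(ybar2_V a1 a2 * bcol1 a1 a2 + ybar2_g a1 a2) * - (a1 * w * \<chi>2 / \<theta>1) =
  a1 / (q * y * z * \<theta>1 * (a1 - a2) * (\<theta>1 - \<chi>1 * t * a1 * a2)) * f3 a1 a2"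
  using nonzero generic unfolding ybar2_V_def ybar2_g_def bcol1_def f3_def by (simp add: divide_simps) algebra

text \<open>The balance that makes the pole-free part of the step fix the second component of
  \<open>ybar\<close>; it accounts for the row \<open>(0, 1)\<close> of
  \<open>Fbar_inf\<close>.\<close>

lemma ybar2_V_ybar2_g: "ybar2_V a1 a2 * (\<chi>1 * t * a1 * a2 / \<theta>1 - 1) = ybar2_g a1 a2 * (brow a1 a2 - brow a2 a1)"
  unfolding brow_diff using nonzero generic unfolding ybar2_V_def ybar2_g_def by (simp add: divide_simps)

end

section \<open>The forms \<open>\<phi>\<^sub>i\<close>, the vector \<open>V\<close> and the step
  \<open>x \<mapsto> q x\<close> on \<open>ybar\<close>\<close>

definition gform :: "complex \<Rightarrow> complex \<Rightarrow> complex ^ 2 \<Rightarrow> complex" where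
  "gform a1 a2 v = brow a1 a2 * v $ 1 + w * \<chi>2 * v $ 2"

lemma gform_linear:
  "gform a1 a2 (u + v) = gform a1 a2 u + gform a1 a2 v"
  "gform a1 a2 (u - v) = gform a1 a2 u - gform a1 a2 v"
  "gform a1 a2 (d *s v) = d * gform a1 a2 v"
  by (simp_all add: gform_def algebra_simps)

lemma B1_mult_vec:
  "(B1 q t a1 a2 a3 a4 \<chi>1 \<chi>2 \<theta>1 \<theta>2 w y z *v v) $ 1 = bcol1 a1 a2 * gform a1 a2 v"
  "(B1 q t a1 a2 a3 a4 \<chi>1 \<chi>2 \<theta>1 \<theta>2 w y z *v v) $ 2 = bcol2 a1 a2 * gform a1 a2 v"
  by (simp_all add: B1_eq gform_def matrix_vector_mult_def sum_2 algebra_simps)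

lemma Binf_mult_vec:
  "(Binf t a1 a2 \<chi>1 \<chi>2 \<theta>1 *v v) $ 1 = \<chi>1 * t * a1 * a2 / \<theta>1 * v $ 1"
  "(Binf t a1 a2 \<chi>1 \<chi>2 \<theta>1 *v v) $ 2 = \<chi>2 * t * a1 * a2 / \<theta>1 * v $ 2"
  by (simp_all add: Binf_def mscale_mult_vec) (simp_all add: matrix_vector_mult_def sum_2)

lemma B0_swap:
  "B0 q t a2 a1 a3 a4 \<chi>1 \<chi>2 \<theta>1 \<theta>2 w y z = B0 q t a1 a2 a3 a4 \<chi>1 \<chi>2 \<theta>1 \<theta>2 w y z"
  by (simp add: B0_def B2_def Binf_def ac_simps diff_diff_eq)

definition conv_vec :: "complex \<Rightarrow> complex \<Rightarrow> complex ^ 2 \<Rightarrow> complex ^ 2 \<Rightarrow> complex ^ 2 \<Rightarrow> complex ^ 2" where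
  "conv_vec a1 a2 U0 U1 U2 =
     B0 q t a1 a2 a3 a4 \<chi>1 \<chi>2 \<theta>1 \<theta>2 w y z *v U0
     + B1 q t a1 a2 a3 a4 \<chi>1 \<chi>2 \<theta>1 \<theta>2 w y z *v U1
     + B2 q t a1 a2 a3 a4 \<chi>1 \<chi>2 \<theta>1 \<theta>2 w y z *v U2"

lemma conv_vec_swap: "conv_vec a2 a1 U0 U2 U1 = conv_vec a1 a2 U0 U1 U2"
  by (simp add: conv_vec_def B0_swap[of a1 a2] B2_def)

lemma conv_vec_nth:
  "conv_vec a1 a2 U0 U1 U2 $ 1 = (1 - \<chi>1 * t * a1 * a2 / \<theta>1) * U0 $ 1
     - bcol1 a1 a2 * gform a1 a2 U0 - bcol1 a2 a1 * gform a2 a1 U0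
     + bcol1 a1 a2 * gform a1 a2 U1 + bcol1 a2 a1 * gform a2 a1 U2"
  "conv_vec a1 a2 U0 U1 U2 $ 2 = (1 - \<chi>2 * t * a1 * a2 / \<theta>1) * U0 $ 2
     - bcol2 a1 a2 * gform a1 a2 U0 - bcol2 a2 a1 * gform a2 a1 U0
     + bcol2 a1 a2 * gform a1 a2 U1 + bcol2 a2 a1 * gform a2 a1 U2"
  by (simp_all add: conv_vec_def B0_def B2_def matrix_vector_mult_diff_rdistrib B1_mult_vec
      Binf_mult_vec left_diff_distrib)

definition ybar :: "complex \<Rightarrow> complex \<Rightarrow> complex \<Rightarrow> complex \<Rightarrow> complex \<Rightarrow> complex ^ 2" where
  "ybar a1 a2 v g1 g2 = vector [ybar1_V a1 a2 * v, ybar2_V a1 a2 * v + ybar2_g a1 a2 * (g1 - g2)]"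

text \<open>Both \<open>ybar2_g\<close> and \<open>g1 - g2\<close> change sign, and the other
  coefficients are symmetric.\<close>

lemma ybar_swap: "ybar a2 a1 v g2 g1 = ybar a1 a2 v g1 g2"
proof -
  have "ybar1_V a2 a1 = ybar1_V a1 a2" "ybar2_V a2 a1 = ybar2_V a1 a2"
    by (simp_all add: ybar1_V_def ybar2_V_def ac_simps)
  moreover have "w * y * \<chi>2 * (a2 - a1) = - (w * y * \<chi>2 * (a1 - a2))"
    by (simp add: algebra_simps)
  then have "ybar2_g a2 a1 * (g2 - g1) = ybar2_g a1 a2 * (g1 - g2)"
    unfolding ybar2_g_def by (simp only: divide_minus_right) (simp add: right_diff_distrib)
  ultimately show ?thesis by (simp add: ybar_def)
qed

text \<open>The row factor of \<open>Fbar1\<close>, scaled so that it returns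
  \<open>h\<^sub>1\<close> of the overview when applied to \<open>ybar\<close>.\<close>

definition h :: "complex \<Rightarrow> complex \<Rightarrow> complex ^ 2 \<Rightarrow> complex" where
  "h a1 a2 v = - (a1 * w * \<chi>2 / \<theta>1) *
     (b1_1 q t a1 a2 a3 a4 \<chi>1 \<chi>2 \<theta>1 \<theta>2 y z * a2 * v $ 1 + f2 a1 a2 * v $ 2)"

context
  fixes a1 a2 :: complex
  assumes a_nonzero: "a1 \<noteq> 0" "a2 \<noteq> 0"
    and relation: "\<chi>1 * \<chi>2 * a1 * a2 * a3 * a4 = \<theta>1 * \<theta>2"
    and generic: "a1 \<noteq> a2" "\<chi>1 * t * a1 * a2 \<noteq> \<theta>1"
begin

lemma h_eq:
  fixes U0 U1 U2 :: "complex ^ 2"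
  defines "V \<equiv> conv_vec a1 a2 U0 U1 U2"
  shows "gform a1 a2 V - (1 - \<chi>2 * t * a1 * a2 / \<theta>1) * gform a1 a2 U1
    = h a1 a2 (ybar a1 a2 (V $ 1) (gform a1 a2 U1) (gform a2 a1 U2))"
proof -
  note ctx = a_nonzero relation generic
  have swap: "a2 \<noteq> 0" "a1 \<noteq> 0" "\<chi>1 * \<chi>2 * a2 * a1 * a3 * a4 = \<theta>1 * \<theta>2" "a2 \<noteq> a1"
      "\<chi>1 * t * a2 * a1 \<noteq> \<theta>1"
    using ctx by (simp_all add: ac_simps)
  define ql where "ql = \<chi>2 * t * a1 * a2 / \<theta>1"
  define n where "n = brow a1 a2 - h_V a1 a2"
  define d where "d = h_g a1 a2"
  let ?g1 = "gform a1 a2 U1" and ?g2 = "gform a2 a1 U2"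
  \<comment> \<open>\<open>n1\<close> and \<open>n2\<close> pair the covector
    \<open>(n, w * \<chi>2)\<close> with the columns of \<open>B1\<close> and \<open>B2\<close>;
    \<open>n3\<close> is the first component of its annihilation of
    \<open>B\<^sub>0\<close>.\<close>
  have n1: "n * bcol1 a1 a2 + w * \<chi>2 * bcol2 a1 a2 = d + 1 - ql"
    unfolding n_def d_def ql_def by (rule left_null1[OF ctx])
  have n2: "n * bcol1 a2 a1 + w * \<chi>2 * bcol2 a2 a1 = - d"
    using left_null1[OF swap] h_g_swap[OF ctx] h_V_diff[OF ctx]
    unfolding n_def d_def by (simp add: ac_simps)
  have n3: "n * (1 - \<chi>1 * t * a1 * a2 / \<theta>1) = (1 - ql) * brow a1 a2 + d * (brow a1 a2 - brow a2 a1)"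
    using left_null2[OF ctx] unfolding n_def d_def ql_def by (simp add: algebra_simps)
  have "n * V $ 1 + w * \<chi>2 * V $ 2
      = n * (1 - \<chi>1 * t * a1 * a2 / \<theta>1) * U0 $ 1 + w * \<chi>2 * (1 - ql) * U0 $ 2
        - (n * bcol1 a1 a2 + w * \<chi>2 * bcol2 a1 a2) * (gform a1 a2 U0 - ?g1)
        - (n * bcol1 a2 a1 + w * \<chi>2 * bcol2 a2 a1) * (gform a2 a1 U0 - ?g2)"
    unfolding V_def conv_vec_nth ql_def by algebra
  \<comment> \<open>All \<open>U0\<close> terms cancel. For the second component of
    \<open>U0\<close> this works because \<open>ql\<close> is the lower eigenvalue of
    \<open>Binf\<close>.\<close>
  also have "\<dots> = (d + 1 - ql) * ?g1 - d * ?g2"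
    unfolding n1 n2 n3 gform_def[of _ _ U0] by algebra
  finally have "gform a1 a2 V - (1 - ql) * ?g1 = h_V a1 a2 * V $ 1 + d * (?g1 - ?g2)"
    unfolding gform_def[of _ _ V] n_def by (simp add: algebra_simps)
  also have "\<dots> = h a1 a2 (ybar a1 a2 (V $ 1) ?g1 ?g2)"
    unfolding h_V_eq[OF ctx] d_def h_g_eq[OF ctx] h_def ybar_def
    by simp (simp add: algebra_simps add_divide_distrib diff_divide_distrib)
  finally show ?thesis unfolding ql_def .
qed

lemma Fbar1_mult_vec:
  "(Fbar1 q t a1 a2 a3 a4 \<chi>1 \<chi>2 \<theta>1 \<theta>2 y z *v v) $ 1 = ybar1_V a1 a2 * bcol1 a1 a2 * h a1 a2 v"
  "(Fbar1 q t a1 a2 a3 a4 \<chi>1 \<chi>2 \<theta>1 \<theta>2 y z *v v) $ 2 = (ybar2_V a1 a2 * bcol1 a1 a2 + ybar2_g a1 a2) * h a1 a2 v"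
proof -
  note ctx = a_nonzero relation generic
  define G where "G = a1 / (q * y * z * \<theta>1 * (a1 - a2) * (\<theta>1 - \<chi>1 * t * a1 * a2))"
  define f1 where "f1 = b1_1 q t a1 a2 a3 a4 \<chi>1 \<chi>2 \<theta>1 \<theta>2 y z"
  have F: "Fbar1 q t a1 a2 a3 a4 \<chi>1 \<chi>2 \<theta>1 \<theta>2 y z = mscale G
      (mat2 (- ((y - t * a1) * f1 * a2^2)) (- (f2 a1 a2 * (y - t * a1) * a2))
            (f1 * f3 a1 a2 * a2) (f2 a1 a2 * f3 a1 a2))"
    by (simp add: Fbar1_def Let_def G_def f1_def f2_def f3_def)
  have "ybar1_V a1 a2 * bcol1 a1 a2 * h a1 a2 v = - (G * (y - t * a1) * a2) * (f1 * a2 * v $ 1 + f2 a1 a2 * v $ 2)"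
    unfolding h_def Fbar_first[OF ctx, folded G_def, symmetric] f1_def by (simp add: ac_simps)
  moreover have "(ybar2_V a1 a2 * bcol1 a1 a2 + ybar2_g a1 a2) * h a1 a2 v
      = G * f3 a1 a2 * (f1 * a2 * v $ 1 + f2 a1 a2 * v $ 2)"
    unfolding h_def Fbar_second[OF ctx, folded G_def, symmetric] f1_def by (simp add: ac_simps)
  moreover have "(mat2 p1 p2 p3 p4 *v v) $ 1 = p1 * v $ 1 + p2 * v $ 2"
    "(mat2 p1 p2 p3 p4 *v v) $ 2 = p3 * v $ 1 + p4 * v $ 2" for p1 p2 p3 p4 :: complex
    by (simp_all add: matrix_vector_mult_def sum_2)
  ultimately show "(Fbar1 q t a1 a2 a3 a4 \<chi>1 \<chi>2 \<theta>1 \<theta>2 y z *v v) $ 1 = ybar1_V a1 a2 * bcol1 a1 a2 * h a1 a2 v"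
    "(Fbar1 q t a1 a2 a3 a4 \<chi>1 \<chi>2 \<theta>1 \<theta>2 y z *v v) $ 2 = (ybar2_V a1 a2 * bcol1 a1 a2 + ybar2_g a1 a2) * h a1 a2 v"
    unfolding F by (simp_all add: mscale_mult_vec power2_eq_square algebra_simps)
qed

end

lemma ybar_step:
  fixes U0 U1 U2 U0' U1' U2' :: "complex ^ 2" and a1 a2 x :: complex
  defines "V \<equiv> conv_vec a1 a2 U0 U1 U2" and "V' \<equiv> conv_vec a1 a2 U0' U1' U2'"
    and "ql \<equiv> \<chi>2 * t * a1 * a2 / \<theta>1"
  assumes ctx: "a1 \<noteq> 0" "a2 \<noteq> 0" "\<chi>1 * \<chi>2 * a1 * a2 * a3 * a4 = \<theta>1 * \<theta>2" "a1 \<noteq> a2"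
      "\<chi>1 * t * a1 * a2 \<noteq> \<theta>1"
    and U0': "U0' = U0 - V"
    and U1': "U1' = U1 - V + (1 / (1 - x / (t * a1))) *s (V - (1 - ql) *s U1)"
    and U2': "U2' = U2 - V + (1 / (1 - x / (t * a2))) *s (V - (1 - ql) *s U2)"
  shows "ybar a1 a2 (V' $ 1) (gform a1 a2 U1') (gform a2 a1 U2') =
    coeffA (t * a1) (t * a2) (Fbar_inf t a1 a2 \<chi>1 \<theta>1)
        (Fbar1 q t a1 a2 a3 a4 \<chi>1 \<chi>2 \<theta>1 \<theta>2 y z) (Fbar2 q t a1 a2 a3 a4 \<chi>1 \<chi>2 \<theta>1 \<theta>2 y z) x
      *v ybar a1 a2 (V $ 1) (gform a1 a2 U1) (gform a2 a1 U2)"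
proof -
  have swap: "a2 \<noteq> 0" "a1 \<noteq> 0" "\<chi>1 * \<chi>2 * a2 * a1 * a3 * a4 = \<theta>1 * \<theta>2" "a2 \<noteq> a1"
      "\<chi>1 * t * a2 * a1 \<noteq> \<theta>1"
    using ctx by (simp_all add: ac_simps)
  define g1 g2 where "g1 = gform a1 a2 U1" and "g2 = gform a2 a1 U2"
  define Yb where "Yb = ybar a1 a2 (V $ 1) g1 g2"
  define d1 d2 where "d1 = 1 / (1 - x / (t * a1))" and "d2 = 1 / (1 - x / (t * a2))"
  define e where "e = \<chi>1 * t * a1 * a2 / \<theta>1"
  have h1: "gform a1 a2 V - (1 - ql) * g1 = h a1 a2 Yb"
    unfolding V_def ql_def g1_def g2_def Yb_def by (rule h_eq[OF ctx])
  have h2: "gform a2 a1 V - (1 - ql) * g2 = h a2 a1 Yb"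
    using h_eq[OF swap, of U0 U2 U1]
    unfolding conv_vec_swap[of a2 a1 U0 U2 U1] ybar_swap[of a2 a1]
    unfolding V_def ql_def g1_def g2_def Yb_def by (simp add: ac_simps)
  have g1': "gform a1 a2 U1' = g1 - gform a1 a2 V + d1 * h a1 a2 Yb"
    unfolding U1' gform_linear h1[symmetric] by (simp add: g1_def d1_def)
  have g2': "gform a2 a1 U2' = g2 - gform a2 a1 V + d2 * h a2 a1 Yb"
    unfolding U2' gform_linear h2[symmetric] by (simp add: g2_def d2_def)
  \<comment> \<open>All three blocks lose \<open>V\<close>, and
    \<open>B\<^sub>0 + B\<^sub>1 + B\<^sub>2 = I - B\<^sub>\<infinity>\<close>, so \<open>V\<close>
    becomes \<open>B\<^sub>\<infinity> V\<close> plus the pole terms.\<close>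
  have V1': "V' $ 1 = e * V $ 1 + d1 * (bcol1 a1 a2 * h a1 a2 Yb) + d2 * (bcol1 a2 a1 * h a2 a1 Yb)"
  proof -
    have "V $ 1 = (1 - e) * U0 $ 1 - bcol1 a1 a2 * gform a1 a2 U0 - bcol1 a2 a1 * gform a2 a1 U0
        + bcol1 a1 a2 * g1 + bcol1 a2 a1 * g2"
      unfolding V_def conv_vec_nth e_def g1_def g2_def ..
    then show ?thesis
      unfolding V'_def conv_vec_nth g1' g2' U0' gform_linear e_def[symmetric]
      by (simp add: algebra_simps)
  qed
  have gform_diff: "gform a1 a2 V - gform a2 a1 V = (brow a1 a2 - brow a2 a1) * V $ 1"
    by (simp add: gform_def algebra_simps)
  have sym: "ybar1_V a2 a1 = ybar1_V a1 a2" "ybar2_V a2 a1 = ybar2_V a1 a2" "ybar2_g a2 a1 = - ybar2_g a1 a2"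
    by (simp_all add: ybar1_V_def ybar2_V_def ybar2_g_def ac_simps)
       (metis (no_types, opaque_lifting) divide_minus_right minus_diff_eq mult_minus_right)
  note F1 = Fbar1_mult_vec[OF ctx] and F2 = Fbar1_mult_vec[OF swap, folded Fbar2_def, unfolded sym]
  have Yb: "Yb $ 1 = ybar1_V a1 a2 * V $ 1" "Yb $ 2 = ybar2_V a1 a2 * V $ 1 + ybar2_g a1 a2 * (g1 - g2)"
    by (simp_all add: Yb_def ybar_def)
  have Finf: "(Fbar_inf t a1 a2 \<chi>1 \<theta>1 *v Yb) $ 1 = e * Yb $ 1" "(Fbar_inf t a1 a2 \<chi>1 \<theta>1 *v Yb) $ 2 = Yb $ 2"
    by (simp_all add: Fbar_inf_def e_def matrix_vector_mult_def sum_2)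
  have "ybar a1 a2 (V' $ 1) (gform a1 a2 U1') (gform a2 a1 U2') $ 1
      = e * Yb $ 1 + d1 * (ybar1_V a1 a2 * bcol1 a1 a2 * h a1 a2 Yb) + d2 * (ybar1_V a1 a2 * bcol1 a2 a1 * h a2 a1 Yb)"
    unfolding ybar_def V1' Yb by (simp add: algebra_simps)
  moreover have "ybar a1 a2 (V' $ 1) (gform a1 a2 U1') (gform a2 a1 U2') $ 2
      = Yb $ 2 + d1 * ((ybar2_V a1 a2 * bcol1 a1 a2 + ybar2_g a1 a2) * h a1 a2 Yb)
        + d2 * ((ybar2_V a1 a2 * bcol1 a2 a1 + - ybar2_g a1 a2) * h a2 a1 Yb)"
  proof -
    have "ybar2_V a1 a2 * e * V $ 1 = ybar2_V a1 a2 * V $ 1 + ybar2_g a1 a2 * (gform a1 a2 V - gform a2 a1 V)"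
      using ybar2_V_ybar2_g[OF ctx] unfolding gform_diff e_def[symmetric] by algebra
    then show ?thesis
      unfolding ybar_def V1' Yb(2) g1' g2' by (simp add: algebra_simps)
  qed
  ultimately show ?thesis
    unfolding Yb_def[unfolded g1_def g2_def, symmetric] vec_eq_iff forall_2 coeffA_mult
      d1_def[symmetric] d2_def[symmetric]
    by (simp add: F1 F2 Finf)
qed

section \<open>Identification of the integrals in \<open>Ybar\<close> with the abstract
  basis\<close>

lemma pole_identity:
  fixes a1 a2 s u u' G1 G2 :: complex
  assumes ctx: "a1 \<noteq> 0" "a2 \<noteq> 0" "\<chi>1 * \<chi>2 * a1 * a2 * a3 * a4 = \<theta>1 * \<theta>2" "a1 \<noteq> a2"
      "\<chi>1 * t * a1 * a2 \<noteq> \<theta>1"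
    and s: "s \<noteq> t * a1" "s \<noteq> t * a2" "s \<noteq> y"
    and G: "G1 - G2 = (brow a1 a2 - brow a2 a1) * u"
    and u': "u' = \<chi>1 * t * a1 * a2 / \<theta>1 * u + bcol1 a1 a2 * G1 / (1 - s / (t * a1))
      + bcol1 a2 a1 * G2 / (1 - s / (t * a2))"
  shows "(q * z * \<theta>1 * u' - t * a1 * a2 * u) / (s - y)
    = q * z * a1 * a2 / (a1 - a2) * (G1 / (s - t * a1) - G2 / (s - t * a2))"
proof -
  define C where "C = q * z * a1 * a2 / (a1 - a2)"
  define A1 A2 where "A1 = G1 / (s - t * a1)" and "A2 = G2 / (s - t * a2)"
  \<comment> \<open>The factor \<open>y - t * a\<close> of \<open>bcol1\<close> equals
    \<open>(s - t * a) - (s - y)\<close>, which splits the term into a multiple of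
    \<open>s - y\<close> and a part free of poles.\<close>
  have pole: "q * z * \<theta>1 * (bcol1 a b * G / (1 - s / (t * a)))
      = q * z * a * b / (a - b) * ((s - y) * (G / (s - t * a)) - G)"
    if "a \<noteq> 0" "a \<noteq> b" "s \<noteq> t * a" for a b G
    using that nonzero unfolding bcol1_def by (simp add: divide_simps) (simp add: algebra_simps)
  have C_swap: "q * z * a2 * a1 / (a2 - a1) = - C"
    using ctx(4) by (simp add: C_def divide_simps) (simp add: algebra_simps)
  \<comment> \<open>The pole-free parts add up to this quantity, which cancels the terms in
    \<open>u\<close>; what remains is divisible by \<open>s - y\<close>.\<close>
  have "C * (G1 - G2) = (q * z * \<chi>1 - 1) * t * a1 * a2 * u"
    unfolding G brow_diff[OF ctx] C_def using nonzero ctx(4) by (simp add: divide_simps)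
  moreover have "q * z * \<theta>1 * u' = q * z * \<chi>1 * t * a1 * a2 * u
      + C * ((s - y) * A1 - G1) + - C * ((s - y) * A2 - G2)"
    unfolding u' distrib_left pole[OF ctx(1,4) s(1)] pole[OF ctx(2) ctx(4)[symmetric] s(2)] C_swap A1_def A2_def
    using nonzero by (simp add: C_def)
  ultimately have "q * z * \<theta>1 * u' - t * a1 * a2 * u
      = (s - y) * (C * (A1 - A2))"
    by algebra
  then show ?thesis using s(3) by (simp add: C_def A1_def A2_def)
qed

text \<open>Partial fractions with \<open>(D2 + \<theta>1) / \<theta>1\<close> in the role of
  \<open>q\<^sup>\<lambda>\<close>: the weight of the second integral is the one treated in
  \<open>jackson_pole_shift\<close> plus a multiple of \<open>1 / (s - x)\<close>, the weight of the
  first.\<close>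

lemma ycheck2_kernel_identity:
  fixes D1 D2 n s x :: complex
  assumes "D1 \<noteq> 0" "s \<noteq> x" "s \<noteq> q * y"
  shows "q * z * \<theta>1 / (s - q * y) - n / (s - y)
      + ((q * z * \<theta>1 - n) / D1 - q^2 * y * z / (s - q * y)) * (D2 / (x - s))
    = (q * z * \<theta>1 * ((x - (D2 + \<theta>1) / \<theta>1 * s) / (x - s)) / (s - q * y) - n / (s - y))
      - (q * z * \<theta>1 - n + q * z * D1) / D1 * D2 / (s - x)"
proof -
  have "q * z * \<theta>1 / (s - q * y) - q^2 * y * z / (s - q * y) * (D2 / (x - s))
    = q * z * \<theta>1 * ((x - (D2 + \<theta>1) / \<theta>1 * s) / (x - s)) / (s - q * y) + q * z * D2 / (x - s)"
    using assms nonzero by (simp add: divide_simps power2_eq_square) (simp add: algebra_simps)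
  moreover have "(q * z * \<theta>1 - n) / D1 * (D2 / (x - s)) + q * z * D2 / (x - s)
     = - ((q * z * \<theta>1 - n + q * z * D1) / D1 * D2 / (s - x))"
    using assms by (simp add: divide_simps) (simp add: algebra_simps)
  ultimately show ?thesis unfolding left_diff_distrib by (simp only: algebra_simps) algebra
qed

lemma Ybar_eq_ybar:
  fixes a1 a2 \<xi> x lam :: complex and Y :: "complex \<Rightarrow> complex ^ 2"
  defines "b \<equiv> vector [0, t * a1, t * a2] :: complex ^ 3"
  defines "W \<equiv> Yhat q lam \<xi> b Y x"
  assumes ctx: "a1 \<noteq> 0" "a2 \<noteq> 0" "\<chi>1 * \<chi>2 * a1 * a2 * a3 * a4 = \<theta>1 * \<theta>2" "a1 \<noteq> a2"
      "\<chi>1 * t * a1 * a2 \<noteq> \<theta>1"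
    and q: "norm q < 1" and \<xi>: "\<xi> \<noteq> 0" and x: "x \<noteq> 0" "x \<notin> q_lattice q \<xi>"
    and lam: "q powr lam = \<chi>2 * t * a1 * a2 / \<theta>1"
    and off: "t * a1 \<notin> q_lattice q \<xi>" "t * a2 \<notin> q_lattice q \<xi>" "y \<notin> q_lattice q \<xi>"
    and Y: "\<And>s. s \<in> q_lattice q \<xi> \<Longrightarrow>
      Y (q * s) = coeffA (t * a1) (t * a2) (Binf t a1 a2 \<chi>1 \<chi>2 \<theta>1)
        (B1 q t a1 a2 a3 a4 \<chi>1 \<chi>2 \<theta>1 \<theta>2 w y z) (B2 q t a1 a2 a3 a4 \<chi>1 \<chi>2 \<theta>1 \<theta>2 w y z) s *v Y s"
    and conv: "\<And>r. jackson_abs_convergent q \<xi> (Yhat_integrand q lam b Y x r)"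
    and conv1: "jackson_abs_convergent q \<xi> (ycheck1_integrand q lam Y x)"
  shows "Ybar q t a1 a2 \<chi>1 \<chi>2 \<theta>1 w y z lam \<xi> Y x =
    ybar a1 a2 (conv_vec a1 a2 (block W 1) (block W 2) (block W 3) $ 1)
      (gform a1 a2 (block W 2)) (gform a2 a1 (block W 3))"
proof -
  note q' = nonzero(1) q
  let ?J = "jackson_integral q \<xi>"
  define P where "P = kernelP q lam x"
  define u where "u = (\<lambda>s. Y s $ 1)"
  define G1 where "G1 = (\<lambda>s. gform a1 a2 (Y s))"
  define G2 where "G2 = (\<lambda>s. gform a2 a1 (Y s))"
  define V1 where "V1 = conv_vec a1 a2 (block W 1) (block W 2) (block W 3) $ 1"
  define e where "e = \<chi>1 * t * a1 * a2 / \<theta>1"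
  define D1 where "D1 = \<chi>1 * t * a1 * a2 - \<theta>1"
  define D2 where "D2 = \<chi>2 * t * a1 * a2 - \<theta>1"
  have D1: "D1 \<noteq> 0" using ctx by (simp add: D1_def)
  have b: "b $ 1 = 0" "b $ 2 = t * a1" "b $ 3 = t * a2" by (simp_all add: b_def)
  have u_step: "u (q * s) = e * u s + bcol1 a1 a2 * G1 s / (1 - s / (t * a1))
      + bcol1 a2 a1 * G2 s / (1 - s / (t * a2))" if "s \<in> q_lattice q \<xi>" for s
    unfolding u_def Y[OF that] G1_def G2_def coeffA_mult B2_def e_def
    by (simp add: B1_mult_vec Binf_mult_vec)
  note Yh = Yhat_functional[OF conv conv, folded W_def P_def]
  have cu: "jackson_abs_convergent q \<xi> (\<lambda>s. P s * u s / s)"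
    using Yh(1)[where i = 1 and m = 1 and n = 0] by (simp add: b u_def)
  have Ju: "block W 1 $ 1 = ?J (\<lambda>s. P s * u s / s)"
    using Yh(2)[where i = 1 and m = 1 and n = 0] by (simp add: b u_def)
  have cG1: "jackson_abs_convergent q \<xi> (\<lambda>s. P s * G1 s / (s - b $ i))"
    and cG2: "jackson_abs_convergent q \<xi> (\<lambda>s. P s * G2 s / (s - b $ i))" for i
    unfolding G1_def G2_def gform_def by (rule Yh(1))+
  have JG1: "gform a1 a2 (block W i) = ?J (\<lambda>s. P s * G1 s / (s - b $ i))"
    and JG2: "gform a2 a1 (block W i) = ?J (\<lambda>s. P s * G2 s / (s - b $ i))" for i
    unfolding G1_def G2_def gform_def by (rule Yh(2))+
  note conv_b = cG1[of 1] cG1[of 2] cG2[of 1] cG2[of 3] and J_b = JG1[of 1] JG1[of 2] JG2[of 1] JG2[of 3]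
  note conv_b = conv_b[unfolded b diff_zero] and J_b = J_b[unfolded b diff_zero]
  have ta: "t * a1 \<noteq> 0" "t * a2 \<noteq> 0" using nonzero ctx by simp_all
  \<comment> \<open>Telescoping is applied to the first component of the equation for
    \<open>Y\<close>, whose pole coefficients are \<open>bcol1\<close> times the forms
    \<open>G1\<close> and \<open>G2\<close>.\<close>
  have V1: "V1 = (1 - q powr lam) * ?J (\<lambda>s. u s / (s - x) * P s)"
    unfolding V1_def conv_vec_nth J_b Ju e_def[symmetric] P_def
    by (rule jackson_telescope[OF q' \<xi> x ta off(1,2) u_step]) (use cu conv_b in \<open>simp_all add: P_def\<close>)
  have ql: "q powr lam = (D2 + \<theta>1) / \<theta>1" by (simp add: lam D2_def)
  have one_ql: "1 - q powr lam = - D2 / \<theta>1"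
    using nonzero by (simp add: ql divide_simps)
  have ycheck1: "ycheck1_integrand q lam Y x = (\<lambda>s. u s / (s - x) * P s)"
    by (simp add: ycheck1_integrand_def u_def P_def fun_eq_iff)
  note c1 = conv1[unfolded ycheck1]
  have first: "t * D2 / (q * w * y * z * \<chi>2 * D1) * ?J (ycheck1_integrand q lam Y x) = ybar1_V a1 a2 * V1"
    unfolding ycheck1 V1 one_ql ybar1_V_def D1_def[symmetric] using nonzero by (simp add: ac_simps)
  let ?H = "\<lambda>s. (q * z * \<theta>1 * ((x - q powr lam * s) / (x - s)) / (s - q * y)
      - t * a1 * a2 / (s - y)) * u s * P s"
  have pole: "(q * z * \<theta>1 * u (q * s) - t * a1 * a2 * u s) / (s - y)
      = q * z * a1 * a2 / (a1 - a2) * (G1 s / (s - t * a1) - G2 s / (s - t * a2))"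
    if "s \<in> q_lattice q \<xi>" for s
  proof (rule pole_identity[OF ctx])
    show "s \<noteq> t * a1" "s \<noteq> t * a2" "s \<noteq> y" using that off by auto
    show "G1 s - G2 s = (brow a1 a2 - brow a2 a1) * u s"
      by (simp add: G1_def G2_def gform_def u_def algebra_simps)
  qed (rule u_step[OF that, unfolded e_def])
  have "q * z * \<theta>1 \<noteq> 0" using nonzero by simp
  note pole_shift = jackson_pole_shift[where q = q and lam = lam and x = x and \<xi> = \<xi>, folded P_def,
      OF q' \<xi> x nonzero(7) off(3) this _ cu conv_b(2,4)]
  have H: "jackson_abs_convergent q \<xi> ?H"
    by (rule pole_shift(1)[OF pole])
  have JH: "?J ?H = q * z * a1 * a2 / (a1 - a2) * (gform a1 a2 (block W 2) - gform a2 a1 (block W 3))"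
    unfolding J_b by (rule pole_shift(2)[OF pole])
  define \<kappa> where "\<kappa> = (q * z * \<theta>1 - t * a1 * a2 + q * z * D1) / D1 * D2"
  have "ycheck2_integrand q t a1 a2 \<chi>1 \<chi>2 \<theta>1 y z lam Y x s = ?H s - \<kappa> * (u s / (s - x) * P s)"
    if "s \<in> q_lattice q \<xi>" for s
  proof -
    have "s \<noteq> x" "s \<noteq> q * y"
      using that x off q_lattice_mult_iff[OF nonzero(1), of y \<xi>] by auto
    note id = ycheck2_kernel_identity[OF D1 this, of "t * a1 * a2" D2]
    show ?thesis
      unfolding ycheck2_integrand_def D1_def[symmetric] D2_def[symmetric] id ql
      by (simp add: \<kappa>_def u_def P_def left_diff_distrib)
  qed
  then have "?J (ycheck2_integrand q t a1 a2 \<chi>1 \<chi>2 \<theta>1 y z lam Y x)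
      = ?J (\<lambda>s. ?H s - \<kappa> * (u s / (s - x) * P s))"
    by (rule jackson_integral_cong)
  also have "\<dots> = ?J ?H - \<kappa> * ?J (\<lambda>s. u s / (s - x) * P s)"
    by (simp only: jackson_integral_diff jackson_integral_cmult jackson_abs_convergent_cmult H c1)
  finally have J2: "?J (ycheck2_integrand q t a1 a2 \<chi>1 \<chi>2 \<theta>1 y z lam Y x)
      = q * z * a1 * a2 / (a1 - a2) * (gform a1 a2 (block W 2) - gform a2 a1 (block W 3))
        - \<kappa> * ?J (\<lambda>s. u s / (s - x) * P s)"
    unfolding JH .
  have ybar2_g: "1 / (q * w * y * z * \<chi>2 * a1 * a2) * (q * z * a1 * a2 / (a1 - a2)) = ybar2_g a1 a2"
    unfolding ybar2_g_def using nonzero ctx by (simp add: divide_simps)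
  \<comment> \<open>Since \<open>V1\<close> is \<open>1 - q powr lam\<close> times the first
    integral, this turns the \<kappa>-term into \<open>ybar2_V a1 a2 * V1\<close>.\<close>
  have ybar2_V: "- (1 / (q * w * y * z * \<chi>2 * a1 * a2) * \<kappa>) = ybar2_V a1 a2 * (1 - q powr lam)"
  proof -
    have "q * z * \<theta>1 - t * a1 * a2 + q * z * D1 = t * a1 * a2 * (q * z * \<chi>1 - 1)"
      by (simp add: D1_def algebra_simps)
    then show ?thesis
      unfolding \<kappa>_def ybar2_V_def one_ql D1_def[symmetric] using nonzero ctx D1
      by (simp add: divide_simps)
  qed
  have "1 / (q * w * y * z * \<chi>2 * a1 * a2) * ?J (ycheck2_integrand q t a1 a2 \<chi>1 \<chi>2 \<theta>1 y z lam Y x)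
      = ybar2_V a1 a2 * V1 + ybar2_g a1 a2 * (gform a1 a2 (block W 2) - gform a2 a1 (block W 3))"
    unfolding J2 V1 ybar2_g[symmetric] mult.assoc[of "ybar2_V a1 a2", symmetric] ybar2_V[symmetric]
    by (simp only: right_diff_distrib mult.assoc) simp
  with first show ?thesis
    unfolding Ybar_def ybar_def V1_def D1_def D2_def by simp
qed

end

section \<open>The q-difference equation for \<open>Ybar\<close>\<close>

theorem theorem3p1:
  fixes q t a1 a2 a3 a4 \<chi>1 \<chi>2 \<theta>1 \<theta>2 w y z lam \<xi> :: complex
    and D :: "complex set"
    and Y :: "complex \<Rightarrow> complex ^ 2"
  assumes q: "0 < norm q" "norm q < 1"
    and nonzero: "t \<noteq> 0" "a1 \<noteq> 0" "a2 \<noteq> 0" "a3 \<noteq> 0" "a4 \<noteq> 0" "\<chi>1 \<noteq> 0" "\<chi>2 \<noteq> 0"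
      "\<theta>1 \<noteq> 0" "\<theta>2 \<noteq> 0" "w \<noteq> 0" "y \<noteq> 0" "z \<noteq> 0" "\<xi> \<noteq> 0"
    and relation: "\<chi>1 * \<chi>2 * a1 * a2 * a3 * a4 = \<theta>1 * \<theta>2"
    and generic: "a1 \<noteq> a2" "\<chi>1 \<noteq> \<chi>2" "\<chi>1 * t * a1 * a2 \<noteq> \<theta>1"
    and lam: "q powr lam = \<chi>2 * t * a1 * a2 / \<theta>1"
    and D: "\<xi> \<in> D" "\<And>s. q * s \<in> D \<longleftrightarrow> s \<in> D"
    and Y: "\<And>s. s \<in> D \<Longrightarrow> s \<noteq> t * a1 \<Longrightarrow> s \<noteq> t * a2 \<Longrightarrow>
      Y (q * s) = coeffA (t * a1) (t * a2) (Binf t a1 a2 \<chi>1 \<chi>2 \<theta>1)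
        (B1 q t a1 a2 a3 a4 \<chi>1 \<chi>2 \<theta>1 \<theta>2 w y z) (B2 q t a1 a2 a3 a4 \<chi>1 \<chi>2 \<theta>1 \<theta>2 w y z) s *v Y s"
    and well_defined: "t * a1 \<notin> q_lattice q \<xi>" "t * a2 \<notin> q_lattice q \<xi>" "y \<notin> q_lattice q \<xi>"
    and conv_Yhat: "\<And>x r. x \<noteq> 0 \<Longrightarrow> x \<notin> q_lattice q \<xi> \<Longrightarrow>
      jackson_abs_convergent q \<xi> (Yhat_integrand q lam (vector [0, t * a1, t * a2]) Y x r)"
    and conv_ycheck1: "\<And>x. x \<noteq> 0 \<Longrightarrow> x \<notin> q_lattice q \<xi> \<Longrightarrow>
      jackson_abs_convergent q \<xi> (ycheck1_integrand q lam Y x)"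
    and conv_ycheck2: "\<And>x. x \<noteq> 0 \<Longrightarrow> x \<notin> q_lattice q \<xi> \<Longrightarrow>
      jackson_abs_convergent q \<xi> (ycheck2_integrand q t a1 a2 \<chi>1 \<chi>2 \<theta>1 y z lam Y x)"
    and Yhat_eq: "\<And>x. x \<noteq> 0 \<Longrightarrow> x \<notin> q_lattice q \<xi> \<Longrightarrow> x \<noteq> t * a1 \<Longrightarrow> x \<noteq> t * a2 \<Longrightarrow>
      Yhat q lam \<xi> (vector [0, t * a1, t * a2]) Y (q * x) =
        (let M0 = B0 q t a1 a2 a3 a4 \<chi>1 \<chi>2 \<theta>1 \<theta>2 w y z;
             M1 = B1 q t a1 a2 a3 a4 \<chi>1 \<chi>2 \<theta>1 \<theta>2 w y z;
             M2 = B2 q t a1 a2 a3 a4 \<chi>1 \<chi>2 \<theta>1 \<theta>2 w y z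
         in coeffA (t * a1) (t * a2) (conv_inf M0 M1 M2)
              (conv1 (q powr lam) M0 M1 M2) (conv2 (q powr lam) M0 M1 M2) x)
        *v Yhat q lam \<xi> (vector [0, t * a1, t * a2]) Y x"
  shows "\<forall>x. x \<noteq> 0 \<longrightarrow> x \<notin> q_lattice q \<xi> \<longrightarrow> x \<noteq> t * a1 \<longrightarrow> x \<noteq> t * a2 \<longrightarrow>
    Ybar q t a1 a2 \<chi>1 \<chi>2 \<theta>1 w y z lam \<xi> Y (q * x) =
      coeffA (t * a1) (t * a2) (Fbar_inf t a1 a2 \<chi>1 \<theta>1)
        (Fbar1 q t a1 a2 a3 a4 \<chi>1 \<chi>2 \<theta>1 \<theta>2 y z) (Fbar2 q t a1 a2 a3 a4 \<chi>1 \<chi>2 \<theta>1 \<theta>2 y z) x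
      *v Ybar q t a1 a2 \<chi>1 \<chi>2 \<theta>1 w y z lam \<xi> Y x"
proof (intro allI impI)
  fix x :: complex
  assume x: "x \<noteq> 0" "x \<notin> q_lattice q \<xi>" "x \<noteq> t * a1" "x \<noteq> t * a2"
  have q0: "q \<noteq> 0" using q by auto
  note \<xi> = nonzero(13) and ctx = nonzero(2,3) relation generic(1,3)
  interpret middle_convolution_parameters q t a3 a4 \<chi>1 \<chi>2 \<theta>1 \<theta>2 w y z
    using q0 nonzero generic by unfold_locales auto
  define W where "W = Yhat q lam \<xi> (vector [0, t * a1, t * a2]) Y"
  have qx: "q * x \<noteq> 0" "q * x \<notin> q_lattice q \<xi>"
    using x q0 q_lattice_mult_iff[OF q0] by auto
  \<comment> \<open>The lattice lies in \<open>D\<close> and avoids both poles of the coefficient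
    matrix.\<close>
  have Y_lattice: "Y (q * s) = coeffA (t * a1) (t * a2) (Binf t a1 a2 \<chi>1 \<chi>2 \<theta>1)
        (B1 q t a1 a2 a3 a4 \<chi>1 \<chi>2 \<theta>1 \<theta>2 w y z) (B2 q t a1 a2 a3 a4 \<chi>1 \<chi>2 \<theta>1 \<theta>2 w y z) s *v Y s"
    if "s \<in> q_lattice q \<xi>" for s
    using that well_defined q_lattice_subset[OF q0 D] by (intro Y) auto
  have Ybar: "Ybar q t a1 a2 \<chi>1 \<chi>2 \<theta>1 w y z lam \<xi> Y x' =
      ybar a1 a2 (conv_vec a1 a2 (block (W x') 1) (block (W x') 2) (block (W x') 3) $ 1)
        (gform a1 a2 (block (W x') 2)) (gform a2 a1 (block (W x') 3))"
    if "x' \<noteq> 0" "x' \<notin> q_lattice q \<xi>" for x'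
    unfolding W_def
    by (rule Ybar_eq_ybar[OF ctx q(2) \<xi> that lam well_defined Y_lattice
          conv_Yhat[OF that] conv_ycheck1[OF that]])
  \<comment> \<open>The convolution equation read blockwise; \<open>lam\<close> replaces
    \<open>q powr lam\<close> by the eigenvalue of \<open>Binf\<close> on which \<open>h_eq\<close>
    relies.\<close>
  note step = conv_step[of "t * a1" "t * a2" "B0 q t a1 a2 a3 a4 \<chi>1 \<chi>2 \<theta>1 \<theta>2 w y z"
      "B1 q t a1 a2 a3 a4 \<chi>1 \<chi>2 \<theta>1 \<theta>2 w y z" "B2 q t a1 a2 a3 a4 \<chi>1 \<chi>2 \<theta>1 \<theta>2 w y z"
      "q powr lam" x "W x", folded conv_vec_def,
      folded Yhat_eq[OF x, unfolded Let_def, folded W_def], unfolded lam]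
  show "Ybar q t a1 a2 \<chi>1 \<chi>2 \<theta>1 w y z lam \<xi> Y (q * x) =
      coeffA (t * a1) (t * a2) (Fbar_inf t a1 a2 \<chi>1 \<theta>1)
        (Fbar1 q t a1 a2 a3 a4 \<chi>1 \<chi>2 \<theta>1 \<theta>2 y z) (Fbar2 q t a1 a2 a3 a4 \<chi>1 \<chi>2 \<theta>1 \<theta>2 y z) x
      *v Ybar q t a1 a2 \<chi>1 \<chi>2 \<theta>1 w y z lam \<xi> Y x"
    unfolding Ybar[OF qx] Ybar[OF x(1,2)] by (rule ybar_step[OF ctx step])
qed

end
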